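(* Let $\gamma>0$, let $\mathcal E$ be a Hilbert space, let $F:[B(\mathcal H)^n]_\gamma^-\to B(\mathcal H)\bar\otimes_{min}B(\mathcal E)$ be a free holomorphic function with coefficients in $B(\mathcal E)$ (that is, free holomorphic on $[B(\mathcal H)^n]_s$ for some $s>\gamma$), and let $r\in(0,\gamma)$. Then $$\sup_{\|X\|=r}\|F(X)\|\le\frac{2r}{\gamma-r}A(\gamma)+\frac{\gamma+r}{\gamma-r}\|F(0)\|,$$ where $A(\gamma):=\sup_{\|y\|=1}\langle\Re F(\gamma S_1,\dots,\gamma S_n)y,y\rangle$ and $S_1,\dots,S_n$ are the left creation operators.
   Context: $\mathcal H$ is a separable infinite dimensional Hilbert space and $n\in\{1,2,\dots\}\cup\{\infty\}$. For $X=(X_1,\dots,X_n)\in B(\mathcal H)^n$, $\|X\|=\|\sum_iX_iX_i^*\|^{1/2}$; $[B(\mathcal H)^n]_s=\{X:\|X\|<s\}$ and $[B(\mathcal H)^n]_\gamma^-=\{X:\|X\|\le\gamma\}$. $\mathbb F_n^+$ is the unital free semigroup on $g_1,\dots,g_n$; for $\alpha=g_{i_1}\cdots g_{i_k}$ put $|\alpha|=k$, $X_\alpha=X_{i_1}\cdots X_{i_k}$ ($X_\alpha=I$ for the neutral element, of length $0$). A free holomorphic function on $[B(\mathcal H)^n]_s$ with coefficients in $B(\mathcal E)$ is a map $F(X)=\sum_{k=0}^\infty\sum_{|\alpha|=k}X_\alpha\otimes A_{(\alpha)}$ with $A_{(\alpha)}\in B(\mathcal E)$, the series in $k$ converging in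 operator norm for all $X\in[B(\mathcal H)^n]_s$ ($\bar\otimes_{min}$ is the spatial tensor product). The same series evaluates $F$ at tuples of row norm $<s$ on any Hilbert space. $\Re T=\frac12(T+T^* )$. $S_i\varphi=e_i\otimes\varphi$ ($i=1,\dots,n$) are the left creation operators on the full Fock space $F^2(H_n)=\mathbb C1\oplus\bigoplus_{k\ge1}H_n^{\otimes k}$, where $H_n$ is an $n$-dimensional Hilbert space with orthonormal basis $e_1,\dots,e_n$; in the definition of $A(\gamma)$, $y$ ranges over unit vectors of $F^2(H_n)\otimes\mathcal E$. *)

theory Defs
  imports "HOL-Analysis.Analysis"
begin

section \<open>Complex Hilbert spaces\<close>

text \<open>The complex inner product is linear in its first argument. The real inner product, hence
  the norm and the topology, is the one induced by its real part.\<close>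

class complex_inner = real_inner +
  fixes scaleC :: "complex \<Rightarrow> 'a \<Rightarrow> 'a" (infixr "*\<^sub>C" 75)
    and cinner :: "'a \<Rightarrow> 'a \<Rightarrow> complex"
  assumes scaleC_add_right: "a *\<^sub>C (x + y) = a *\<^sub>C x + a *\<^sub>C y"
    and scaleC_add_left: "(a + b) *\<^sub>C x = a *\<^sub>C x + b *\<^sub>C x"
    and scaleC_scaleC: "a *\<^sub>C (b *\<^sub>C x) = (a * b) *\<^sub>C x"
    and scaleC_one: "1 *\<^sub>C x = x"
    and scaleR_scaleC: "r *\<^sub>R x = complex_of_real r *\<^sub>C x"
    and cinner_commute: "cinner x y = cnj (cinner y x)"
    and cinner_add_left: "cinner (x + y) z = cinner x z + cinner y z"
    and cinner_scaleC_left: "cinner (a *\<^sub>C x) y = a * cinner x y"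
    and inner_eq_Re_cinner: "inner x y = Re (cinner x y)"

class chilbert_space = complex_inner + complete_space

global_interpretation complex_vector:
  vector_space "scaleC :: complex \<Rightarrow> 'a \<Rightarrow> 'a::complex_inner"
  defines cspan = complex_vector.span
  by unfold_locales (simp_all add: scaleC_add_right scaleC_add_left scaleC_scaleC scaleC_one)

definition separable_hilbert :: "'a::complex_inner itself \<Rightarrow> bool" where
  "separable_hilbert _ \<longleftrightarrow> separable_space (euclidean :: 'a topology)"

definition infinite_dimensional :: "'a::complex_inner itself \<Rightarrow> bool" where
  "infinite_dimensional _ \<longleftrightarrow> \<not> (\<exists>B :: 'a set. finite B \<and> cspan B = UNIV)"


section \<open>Bounded operators\<close>

text \<open>The type of bounded real-linear maps carries the operator norm; the bounded operators in the
  complex sense are its complex-linear elements.\<close>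

definition bounded_ops :: "('a::complex_inner \<Rightarrow>\<^sub>L 'b::complex_inner) set" where
  "bounded_ops = {T. \<forall>c x. blinfun_apply T (c *\<^sub>C x) = c *\<^sub>C blinfun_apply T x}"

definition cadjoint ::
  "('a::chilbert_space \<Rightarrow>\<^sub>L 'b::chilbert_space) \<Rightarrow> ('b \<Rightarrow>\<^sub>L 'a)" where
  "cadjoint T = (THE S. S \<in> bounded_ops \<and>
     (\<forall>x y. cinner (blinfun_apply T x) y = cinner x (blinfun_apply S y)))"

definition real_part :: "('a::chilbert_space \<Rightarrow>\<^sub>L 'a) \<Rightarrow> ('a \<Rightarrow>\<^sub>L 'a)" where
  "real_part T = (1/2) *\<^sub>R (T + cadjoint T)"

text \<open>Sums of operator families are unordered and converge in the strong operator topology. For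
  finite index sets they are the plain sums; for infinitely many variables norm convergence
  would be too restrictive: already the sum of all \<open>S\<^sub>i S\<^sub>i\<^sup>*\<close> converges only strongly.\<close>

definition has_strong_sum ::
  "('j \<Rightarrow> 'a::real_normed_vector \<Rightarrow>\<^sub>L 'b::real_normed_vector) \<Rightarrow> ('a \<Rightarrow>\<^sub>L 'b) \<Rightarrow> 'j set \<Rightarrow> bool" where
  "has_strong_sum f T J \<longleftrightarrow>
     (\<forall>x. ((\<lambda>j. blinfun_apply (f j) x) has_sum blinfun_apply T x) J)"

definition strongly_summable ::
  "('j \<Rightarrow> 'a::real_normed_vector \<Rightarrow>\<^sub>L 'b::real_normed_vector) \<Rightarrow> 'j set \<Rightarrow> bool" where
  "strongly_summable f J \<longleftrightarrow> (\<exists>T. has_strong_sum f T J)"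

definition strong_sum ::
  "('j \<Rightarrow> 'a::real_normed_vector \<Rightarrow>\<^sub>L 'b::real_normed_vector) \<Rightarrow> 'j set \<Rightarrow> ('a \<Rightarrow>\<^sub>L 'b)" where
  "strong_sum f J = (THE T. has_strong_sum f T J)"


section \<open>Operator tuples and noncommutative balls\<close>

text \<open>The generators are indexed by a type \<open>'i\<close> of class \<open>countable\<close>; its cardinality, which is at
  least one and possibly infinite, is the number \<open>n\<close> of variables. Words are lists over \<open>'i\<close>.

  If \<open>'i\<close> is infinite, an element of \<open>B(H)\<^sup>n\<close> is required to define a bounded row operator,
  that is, the sum of all \<open>X\<^sub>i X\<^sub>i\<^sup>*\<close> has to converge strongly.\<close>

definition op_tuples :: "('i::countable \<Rightarrow> ('a::chilbert_space \<Rightarrow>\<^sub>L 'a)) set" where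
  "op_tuples = {X. (\<forall>i. X i \<in> bounded_ops) \<and>
                   strongly_summable (\<lambda>i. X i o\<^sub>L cadjoint (X i)) UNIV}"

definition row_norm :: "('i::countable \<Rightarrow> ('a::chilbert_space \<Rightarrow>\<^sub>L 'a)) \<Rightarrow> real" where
  "row_norm X = sqrt (norm (strong_sum (\<lambda>i. X i o\<^sub>L cadjoint (X i)) UNIV))"

definition row_ball :: "real \<Rightarrow> ('i::countable \<Rightarrow> ('a::chilbert_space \<Rightarrow>\<^sub>L 'a)) set" where
  "row_ball s = {X \<in> op_tuples. row_norm X < s}"

definition row_cball :: "real \<Rightarrow> ('i::countable \<Rightarrow> ('a::chilbert_space \<Rightarrow>\<^sub>L 'a)) set" where
  "row_cball s = {X \<in> op_tuples. row_norm X \<le> s}"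

definition row_sphere :: "real \<Rightarrow> ('i::countable \<Rightarrow> ('a::chilbert_space \<Rightarrow>\<^sub>L 'a)) set" where
  "row_sphere s = {X \<in> op_tuples. row_norm X = s}"

primrec word_op ::
  "('i \<Rightarrow> ('a::real_normed_vector \<Rightarrow>\<^sub>L 'a)) \<Rightarrow> 'i list \<Rightarrow> ('a \<Rightarrow>\<^sub>L 'a)" where
  "word_op X [] = id_blinfun"
| "word_op X (i # w) = X i o\<^sub>L word_op X w"


section \<open>Hilbert space tensor products\<close>

text \<open>The Hilbert space tensor product is determined up to a unique unitary by the following
  property, so it is represented by any Hilbert space \<open>'k\<close> together with a map
  \<open>t x y = x \<otimes> y\<close> into it.\<close>

definition hilbert_tensor ::
  "('a::chilbert_space \<Rightarrow> 'b::chilbert_space \<Rightarrow> 'k::chilbert_space) \<Rightarrow> bool" where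
  "hilbert_tensor t \<longleftrightarrow>
     (\<forall>x x' y. t (x + x') y = t x y + t x' y) \<and>
     (\<forall>x y y'. t x (y + y') = t x y + t x y') \<and>
     (\<forall>c x y. t (c *\<^sub>C x) y = c *\<^sub>C t x y) \<and>
     (\<forall>c x y. t x (c *\<^sub>C y) = c *\<^sub>C t x y) \<and>
     (\<forall>x x' y y'. cinner (t x y) (t x' y') = cinner x x' * cinner y y') \<and>
     closure (cspan {t x y | x y. True}) = UNIV"

text \<open>The operator \<open>T \<otimes> B\<close> on the tensor product given by \<open>t\<close>.\<close>

definition tensor_op ::
  "('a::chilbert_space \<Rightarrow> 'b::chilbert_space \<Rightarrow> 'k::chilbert_space) \<Rightarrow>
   ('a \<Rightarrow>\<^sub>L 'a) \<Rightarrow> ('b \<Rightarrow>\<^sub>L 'b) \<Rightarrow> ('k \<Rightarrow>\<^sub>L 'k)" where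
  "tensor_op t T B = (THE R. R \<in> bounded_ops \<and>
     (\<forall>x y. blinfun_apply R (t x y) = t (blinfun_apply T x) (blinfun_apply B y)))"

text \<open>The real span below is the complex span, since \<open>c (T \<otimes> B) = (c T) \<otimes> B\<close>. The closure is taken in
  the operator norm.\<close>

definition spatial_tensor ::
  "('a::chilbert_space \<Rightarrow> 'b::chilbert_space \<Rightarrow> 'k::chilbert_space) \<Rightarrow> ('k \<Rightarrow>\<^sub>L 'k) set" where
  "spatial_tensor t =
     closure (span {tensor_op t T B | T B. T \<in> bounded_ops \<and> B \<in> bounded_ops})"


section \<open>Free holomorphic functions\<close>

text \<open>The homogeneous part of degree \<open>k\<close>, the series at a tuple \<open>X\<close> (its terms being added in
  operator norm), and the functions given by such a series on a whole open ball.\<close>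

definition homogeneous_term ::
  "('a::chilbert_space \<Rightarrow> 'e::chilbert_space \<Rightarrow> 'k::chilbert_space) \<Rightarrow>
   ('i::countable list \<Rightarrow> ('e \<Rightarrow>\<^sub>L 'e)) \<Rightarrow> ('i \<Rightarrow> ('a \<Rightarrow>\<^sub>L 'a)) \<Rightarrow> 'i list \<Rightarrow> ('k \<Rightarrow>\<^sub>L 'k)" where
  "homogeneous_term t A X w = tensor_op t (word_op X w) (A w)"

definition homogeneous_part ::
  "('a::chilbert_space \<Rightarrow> 'e::chilbert_space \<Rightarrow> 'k::chilbert_space) \<Rightarrow>
   ('i::countable list \<Rightarrow> ('e \<Rightarrow>\<^sub>L 'e)) \<Rightarrow> ('i \<Rightarrow> ('a \<Rightarrow>\<^sub>L 'a)) \<Rightarrow> nat \<Rightarrow> ('k \<Rightarrow>\<^sub>L 'k)" where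
  "homogeneous_part t A X k = strong_sum (homogeneous_term t A X) {w. length w = k}"

definition free_eval ::
  "('a::chilbert_space \<Rightarrow> 'e::chilbert_space \<Rightarrow> 'k::chilbert_space) \<Rightarrow>
   ('i::countable list \<Rightarrow> ('e \<Rightarrow>\<^sub>L 'e)) \<Rightarrow> ('i \<Rightarrow> ('a \<Rightarrow>\<^sub>L 'a)) \<Rightarrow> ('k \<Rightarrow>\<^sub>L 'k)" where
  "free_eval t A X = (\<Sum>k. homogeneous_part t A X k)"

definition free_holomorphic_on ::
  "('a::chilbert_space \<Rightarrow> 'e::chilbert_space \<Rightarrow> 'k::chilbert_space) \<Rightarrow> real \<Rightarrow>
   ('i::countable list \<Rightarrow> ('e \<Rightarrow>\<^sub>L 'e)) \<Rightarrow>
   (('i \<Rightarrow> ('a \<Rightarrow>\<^sub>L 'a)) \<Rightarrow> ('k \<Rightarrow>\<^sub>L 'k)) \<Rightarrow> bool" where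
  "free_holomorphic_on t s A F \<longleftrightarrow>
     (\<forall>w. A w \<in> bounded_ops) \<and>
     (\<forall>X \<in> row_ball s.
        (\<forall>k. strongly_summable (homogeneous_term t A X) {w. length w = k}) \<and>
        homogeneous_part t A X sums F X)"


section \<open>The full Fock space and the left creation operators\<close>

typedef 'j ell2 = "{f :: 'j \<Rightarrow> complex. (\<lambda>j. (cmod (f j))\<^sup>2) summable_on UNIV}"
  morphisms ell2_coeff Abs_ell2
  by (rule exI[of _ "\<lambda>_. 0"]) simp

setup_lifting type_definition_ell2

lemma ell2_summable: "(\<lambda>j. (cmod (ell2_coeff f j))\<^sup>2) summable_on UNIV"
  using ell2_coeff by auto

lemma ell2_eqI: "(\<And>j. ell2_coeff f j = ell2_coeff g j) \<Longrightarrow> f = g"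
  by transfer auto

lemma square_summable_add:
  fixes f g :: "'j \<Rightarrow> complex"
  assumes "(\<lambda>j. (cmod (f j))\<^sup>2) summable_on UNIV" "(\<lambda>j. (cmod (g j))\<^sup>2) summable_on UNIV"
  shows "(\<lambda>j. (cmod (f j + g j))\<^sup>2) summable_on UNIV"
proof (rule summable_on_comparison_test)
  show "(\<lambda>j. 2 * (cmod (f j))\<^sup>2 + 2 * (cmod (g j))\<^sup>2) summable_on UNIV"
    by (intro summable_on_add summable_on_cmult_right assms)
  fix j
  have "(cmod (f j + g j))\<^sup>2 \<le> (cmod (f j) + cmod (g j))\<^sup>2"
    by (simp add: norm_triangle_ineq power_mono)
  also have "\<dots> \<le> 2 * (cmod (f j))\<^sup>2 + 2 * (cmod (g j))\<^sup>2"
    using zero_le_power2[of "cmod (f j) - cmod (g j)"] by (simp add: power2_eq_square algebra_simps)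
  finally show "(cmod (f j + g j))\<^sup>2 \<le> 2 * (cmod (f j))\<^sup>2 + 2 * (cmod (g j))\<^sup>2" .
qed auto

lemma square_summable_scale:
  fixes f :: "'j \<Rightarrow> complex"
  assumes "(\<lambda>j. (cmod (f j))\<^sup>2) summable_on UNIV"
  shows "(\<lambda>j. (cmod (c * f j))\<^sup>2) summable_on UNIV"
  using summable_on_cmult_right[OF assms, of "(cmod c)\<^sup>2"]
  by (simp add: norm_mult power_mult_distrib)

lemma ell2_cinner_summable: "(\<lambda>j. ell2_coeff f j * cnj (ell2_coeff g j)) summable_on UNIV"
proof (rule abs_summable_summable, rule summable_on_comparison_test)
  show "(\<lambda>j. (cmod (ell2_coeff f j))\<^sup>2 + (cmod (ell2_coeff g j))\<^sup>2) summable_on UNIV"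
    by (intro summable_on_add ell2_summable)
  fix j
  have "cmod (ell2_coeff f j) * cmod (ell2_coeff g j) * 2
      \<le> (cmod (ell2_coeff f j))\<^sup>2 + (cmod (ell2_coeff g j))\<^sup>2"
    using zero_le_power2[of "cmod (ell2_coeff f j) - cmod (ell2_coeff g j)"]
    by (simp add: power2_eq_square algebra_simps)
  moreover have "0 \<le> cmod (ell2_coeff f j) * cmod (ell2_coeff g j)" by simp
  ultimately show "norm (ell2_coeff f j * cnj (ell2_coeff g j))
      \<le> (cmod (ell2_coeff f j))\<^sup>2 + (cmod (ell2_coeff g j))\<^sup>2"
    unfolding norm_mult complex_mod_cnj by linarith
qed auto

instantiation ell2 :: (type) complex_inner
begin

lift_definition zero_ell2 :: "'a ell2" is "\<lambda>_. 0" by simp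
lift_definition plus_ell2 :: "'a ell2 \<Rightarrow> 'a ell2 \<Rightarrow> 'a ell2" is "\<lambda>f g j. f j + g j"
  by (rule square_summable_add)
lift_definition scaleC_ell2 :: "complex \<Rightarrow> 'a ell2 \<Rightarrow> 'a ell2" is "\<lambda>c f j. c * f j"
  by (rule square_summable_scale)
lift_definition uminus_ell2 :: "'a ell2 \<Rightarrow> 'a ell2" is "\<lambda>f j. - f j" by simp
lift_definition minus_ell2 :: "'a ell2 \<Rightarrow> 'a ell2 \<Rightarrow> 'a ell2" is "\<lambda>f g j. f j - g j"
proof -
  fix f g :: "'a \<Rightarrow> complex"
  assume "(\<lambda>j. (cmod (f j))\<^sup>2) summable_on UNIV" "(\<lambda>j. (cmod (g j))\<^sup>2) summable_on UNIV"
  then show "(\<lambda>j. (cmod (f j - g j))\<^sup>2) summable_on UNIV"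
    using square_summable_add[of f "\<lambda>j. - g j"] by simp
qed

definition "scaleR r f = complex_of_real r *\<^sub>C (f :: 'a ell2)"
definition "cinner f g = (\<Sum>\<^sub>\<infinity>j. ell2_coeff f j * cnj (ell2_coeff (g :: 'a ell2) j))"
definition "inner f g = Re (cinner f (g :: 'a ell2))"
definition "norm f = sqrt (inner f (f :: 'a ell2))"
definition "dist f g = norm (f - (g :: 'a ell2))"
definition "sgn f = inverse (norm f) *\<^sub>R (f :: 'a ell2)"
definition "uniformity = (INF e\<in>{0<..}. principal {(f, g :: 'a ell2). dist f g < e})"
definition "open U = (\<forall>f\<in>U. eventually (\<lambda>(f', g). f' = f \<longrightarrow> (g :: 'a ell2) \<in> U) uniformity)"

lemma cinner_ell2_self:
  "cinner f f = complex_of_real (\<Sum>\<^sub>\<infinity>j. (cmod (ell2_coeff (f :: 'a ell2) j))\<^sup>2)"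
proof -
  have "((\<lambda>j. complex_of_real ((cmod (ell2_coeff f j))\<^sup>2)) has_sum
         complex_of_real (\<Sum>\<^sub>\<infinity>j. (cmod (ell2_coeff f j))\<^sup>2)) UNIV"
    by (intro has_sum_of_real has_sum_infsum ell2_summable)
  then show ?thesis
    unfolding cinner_ell2_def complex_norm_square by (rule infsumI)
qed

lemma cinner_ell2_commute: "cinner f g = cnj (cinner g (f :: 'a ell2))"
  unfolding cinner_ell2_def infsum_cnj[symmetric] by (simp add: mult.commute)

lemma cinner_ell2_add: "cinner (f + g) h = cinner f h + cinner g (h :: 'a ell2)"
  unfolding cinner_ell2_def plus_ell2.rep_eq distrib_right
  by (intro infsum_add ell2_cinner_summable)

lemma cinner_ell2_scale: "cinner (c *\<^sub>C f) h = c * cinner f (h :: 'a ell2)"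
  unfolding cinner_ell2_def scaleC_ell2.rep_eq mult.assoc
  by (intro infsum_cmult_right ell2_cinner_summable)

instance
proof
  fix f g h :: "'a ell2" and a b :: complex and r s :: real
  show "f + g + h = f + (g + h)" "f + g = g + f" "0 + f = f" "- f + f = 0" "f - g = f + - g"
    by (transfer; simp add: fun_eq_iff)+
  show "a *\<^sub>C (f + g) = a *\<^sub>C f + a *\<^sub>C g" "(a + b) *\<^sub>C f = a *\<^sub>C f + b *\<^sub>C f"
    "a *\<^sub>C (b *\<^sub>C f) = (a * b) *\<^sub>C f" "1 *\<^sub>C f = f"
    by (transfer; simp add: fun_eq_iff algebra_simps)+
  show "r *\<^sub>R (f + g) = r *\<^sub>R f + r *\<^sub>R g" "(r + s) *\<^sub>R f = r *\<^sub>R f + s *\<^sub>R f"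
    "r *\<^sub>R (s *\<^sub>R f) = (r * s) *\<^sub>R f" "1 *\<^sub>R f = f"
    unfolding scaleR_ell2_def by (transfer; simp add: fun_eq_iff algebra_simps)+
  show "r *\<^sub>R f = complex_of_real r *\<^sub>C f" by (rule scaleR_ell2_def)
  show "cinner f g = cnj (cinner g f)" by (rule cinner_ell2_commute)
  show "cinner (f + g) h = cinner f h + cinner g h" by (rule cinner_ell2_add)
  show "cinner (a *\<^sub>C f) g = a * cinner f g" by (rule cinner_ell2_scale)
  show "inner f g = Re (cinner f g)" by (rule inner_ell2_def)
  show "inner f g = inner g f"
    unfolding inner_ell2_def by (subst cinner_ell2_commute) simp
  show "inner (f + g) h = inner f h + inner g h"
    unfolding inner_ell2_def cinner_ell2_add by simp
  show "inner (r *\<^sub>R f) g = r * inner f g"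
    unfolding inner_ell2_def scaleR_ell2_def cinner_ell2_scale by simp
  show "0 \<le> inner f f"
    unfolding inner_ell2_def cinner_ell2_self by (simp add: infsum_nonneg)
  show "inner f f = 0 \<longleftrightarrow> f = 0"
  proof
    assume "inner f f = 0"
    then have "(\<Sum>\<^sub>\<infinity>j. (cmod (ell2_coeff f j))\<^sup>2) = 0"
      unfolding inner_ell2_def cinner_ell2_self by simp
    then have "(cmod (ell2_coeff f j))\<^sup>2 = 0" for j
      by (intro nonneg_infsum_le_0D[OF _ ell2_summable]) auto
    then show "f = 0" by (intro ell2_eqI) (simp add: zero_ell2.rep_eq)
  next
    assume "f = 0"
    then show "inner f f = 0"
      unfolding inner_ell2_def cinner_ell2_self by (simp add: zero_ell2.rep_eq)
  qed
qed (fact norm_ell2_def dist_ell2_def sgn_ell2_def uniformity_ell2_def open_ell2_def)+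

end

lemma norm_ell2: "(norm f)\<^sup>2 = (\<Sum>\<^sub>\<infinity>j. (cmod (ell2_coeff f j))\<^sup>2)"
  unfolding power2_norm_eq_inner inner_ell2_def cinner_ell2_self by simp

lemma norm_ell2_partial: "finite J \<Longrightarrow> (\<Sum>j\<in>J. (cmod (ell2_coeff f j))\<^sup>2) \<le> (norm f)\<^sup>2"
  unfolding norm_ell2 by (rule finite_sum_le_infsum[OF ell2_summable]) auto

lemma norm_ell2_coeff: "cmod (ell2_coeff f j) \<le> norm f"
  using norm_ell2_partial[of "{j}" f] by (simp add: power2_le_iff_abs_le)

instance ell2 :: (type) chilbert_space
proof
  fix X :: "nat \<Rightarrow> 'a ell2"
  assume X: "Cauchy X"
  have "Cauchy (\<lambda>n. ell2_coeff (X n) j)" for j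
  proof (rule CauchyI)
    fix e :: real assume "e > 0"
    then obtain M where M: "\<forall>m\<ge>M. \<forall>n\<ge>M. norm (X m - X n) < e" using CauchyD[OF X] by blast
    have "cmod (ell2_coeff (X m) j - ell2_coeff (X n) j) \<le> norm (X m - X n)" for m n
      using norm_ell2_coeff[of "X m - X n" j] by (simp add: minus_ell2.rep_eq)
    then show "\<exists>M. \<forall>m\<ge>M. \<forall>n\<ge>M. cmod (ell2_coeff (X m) j - ell2_coeff (X n) j) < e"
      using M le_less_trans by blast
  qed
  then obtain g where g: "\<And>j. (\<lambda>n. ell2_coeff (X n) j) \<longlonglongrightarrow> g j"
    unfolding Cauchy_convergent_iff convergent_def by metis
  have lim: "(\<Sum>j\<in>J. (cmod (ell2_coeff (X m) j - g j))\<^sup>2) \<le> e\<^sup>2"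
    if "finite J" "\<forall>n\<ge>M. norm (X m - X n) < e" for J m M and e :: real
  proof (rule LIMSEQ_le_const2)
    show "(\<lambda>n. \<Sum>j\<in>J. (cmod (ell2_coeff (X m) j - ell2_coeff (X n) j))\<^sup>2)
        \<longlonglongrightarrow> (\<Sum>j\<in>J. (cmod (ell2_coeff (X m) j - g j))\<^sup>2)"
      by (intro tendsto_intros g)
    have "(\<Sum>j\<in>J. (cmod (ell2_coeff (X m) j - ell2_coeff (X n) j))\<^sup>2) \<le> e\<^sup>2" if "n \<ge> M" for n
    proof -
      have "(\<Sum>j\<in>J. (cmod (ell2_coeff (X m) j - ell2_coeff (X n) j))\<^sup>2) \<le> (norm (X m - X n))\<^sup>2"
        using norm_ell2_partial[OF \<open>finite J\<close>, of "X m - X n"] by (simp add: minus_ell2.rep_eq)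
      also have "\<dots> \<le> e\<^sup>2" using that \<open>\<forall>n\<ge>M. norm (X m - X n) < e\<close> by (intro power_mono) auto
      finally show ?thesis .
    qed
    then show "\<exists>N. \<forall>n\<ge>N. (\<Sum>j\<in>J. (cmod (ell2_coeff (X m) j - ell2_coeff (X n) j))\<^sup>2) \<le> e\<^sup>2"
      by blast
  qed
  have diff: "(\<lambda>j. (cmod (ell2_coeff (X m) j - g j))\<^sup>2) summable_on UNIV"
    if "\<forall>n\<ge>M. norm (X m - X n) < e" for m M and e :: real
    by (rule nonneg_bdd_above_summable_on) (auto intro!: bdd_aboveI2 lim[OF _ that])
  obtain M1 where M1: "\<forall>m\<ge>M1. \<forall>n\<ge>M1. norm (X m - X n) < 1" using CauchyD[OF X, of 1] by auto
  have "(\<lambda>j. (cmod (ell2_coeff (X M1) j + - (ell2_coeff (X M1) j - g j)))\<^sup>2) summable_on UNIV"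
    by (rule square_summable_add[OF ell2_summable])
      (simp add: norm_minus_commute[of "g _"] diff[of M1 M1 1] M1)
  then have "(\<lambda>j. (cmod (g j))\<^sup>2) summable_on UNIV" by simp
  then have coeff: "ell2_coeff (Abs_ell2 g) = g" by (simp add: Abs_ell2_inverse)
  have "X \<longlonglongrightarrow> Abs_ell2 g"
  proof (rule LIMSEQ_I)
    fix e :: real assume "e > 0"
    then obtain M where M: "\<forall>m\<ge>M. \<forall>n\<ge>M. norm (X m - X n) < e / 2"
      using CauchyD[OF X, of "e / 2"] by auto
    have "norm (X m - Abs_ell2 g) < e" if "m \<ge> M" for m
    proof -
      have m: "\<forall>n\<ge>M. norm (X m - X n) < e / 2" using M that by blast
      have "(norm (X m - Abs_ell2 g))\<^sup>2 \<le> (e / 2)\<^sup>2"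
        unfolding norm_ell2 minus_ell2.rep_eq coeff
        by (rule infsum_le_finite_sums[OF diff[OF m]]) (use lim[OF _ m] in auto)
      then have "norm (X m - Abs_ell2 g) \<le> e / 2"
        using \<open>e > 0\<close> by (simp add: power2_le_iff_abs_le)
      then show ?thesis using \<open>e > 0\<close> by simp
    qed
    then show "\<exists>M. \<forall>m\<ge>M. norm (X m - Abs_ell2 g) < e" by blast
  qed
  then show "convergent X" by (rule convergentI)
qed

text \<open>\<open>H\<^sub>n\<close> is \<open>'i ell2\<close>, with orthonormal basis \<open>e\<^sub>i = ell2_basis i\<close>. The vectors
  \<open>e\<^sub>i\<^sub>1 \<otimes> \<dots> \<otimes> e\<^sub>i\<^sub>k\<close>, indexed by the words of length \<open>k\<close>, form an orthonormal basis of the \<open>k\<close>-fold tensor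
  power of \<open>H\<^sub>n\<close> (for \<open>k = 0\<close>: the vacuum vector, indexed by the empty word). In these coordinates the
  orthogonal sum of all tensor powers is the space of square summable families indexed by all
  words.\<close>

type_synonym 'i fock = "'i list ell2"

lift_definition ell2_basis :: "'j \<Rightarrow> 'j ell2" is "\<lambda>i j. if j = i then 1 else 0"
proof -
  fix i :: 'j
  show "(\<lambda>j. (cmod (if j = i then 1 else 0))\<^sup>2) summable_on UNIV"
    by (rule finite_nonzero_values_imp_summable_on) (simp add: if_distrib cong: if_cong)
qed

lemma fock_tensor_has_sum:
  fixes h :: "'i ell2" and \<phi> :: "'i fock"
  shows "((\<lambda>w. (cmod (case w of [] \<Rightarrow> 0 | i # v \<Rightarrow> ell2_coeff h i * ell2_coeff \<phi> v))\<^sup>2)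
            has_sum ((norm h)\<^sup>2 * (norm \<phi>)\<^sup>2)) UNIV"
proof -
  have "((\<lambda>(i, v). (cmod (ell2_coeff h i))\<^sup>2 * (cmod (ell2_coeff \<phi> v))\<^sup>2)
          has_sum ((norm h)\<^sup>2 * (norm \<phi>)\<^sup>2)) (UNIV \<times> UNIV)"
  proof (rule has_sum_SigmaI)
    show "((\<lambda>v. case (i, v) of (i, v) \<Rightarrow> (cmod (ell2_coeff h i))\<^sup>2 * (cmod (ell2_coeff \<phi> v))\<^sup>2)
        has_sum (cmod (ell2_coeff h i))\<^sup>2 * (norm \<phi>)\<^sup>2) UNIV" for i
      using has_sum_cmult_right[OF has_sum_infsum[OF ell2_summable[of \<phi>]]] by (simp add: norm_ell2)
    show "((\<lambda>i. (cmod (ell2_coeff h i))\<^sup>2 * (norm \<phi>)\<^sup>2) has_sum (norm h)\<^sup>2 * (norm \<phi>)\<^sup>2) UNIV"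
      using has_sum_cmult_left[OF has_sum_infsum[OF ell2_summable[of h]]] by (simp add: norm_ell2)
    show "(\<lambda>(i, v). (cmod (ell2_coeff h i))\<^sup>2 * (cmod (ell2_coeff \<phi> v))\<^sup>2)
        summable_on UNIV \<times> UNIV"
      by (rule summable_on_SigmaI[where g = "\<lambda>i. (cmod (ell2_coeff h i))\<^sup>2 * (norm \<phi>)\<^sup>2"])
        (use has_sum_cmult_right[OF has_sum_infsum[OF ell2_summable[of \<phi>]]]
          summable_on_cmult_left[OF ell2_summable[of h]] in \<open>auto simp: norm_ell2\<close>)
  qed
  then have "((\<lambda>w. (cmod (case w of [] \<Rightarrow> 0 | i # v \<Rightarrow> ell2_coeff h i * ell2_coeff \<phi> v))\<^sup>2)
            has_sum ((norm h)\<^sup>2 * (norm \<phi>)\<^sup>2)) (range (\<lambda>(i, v). i # v))"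
    by (subst has_sum_reindex)
      (auto simp: inj_on_def o_def case_prod_unfold norm_mult power_mult_distrib)
  then show ?thesis
    by (rule has_sum_cong_neutral[THEN iffD1, rotated -1]) (auto split: list.splits)
qed

text \<open>The vector \<open>h \<otimes> \<phi>\<close> of the Fock space, for \<open>h\<close> in \<open>H\<^sub>n\<close>.\<close>

lift_definition fock_tensor :: "'i ell2 \<Rightarrow> 'i fock \<Rightarrow> 'i fock" is
  "\<lambda>h \<phi> w. case w of [] \<Rightarrow> 0 | i # v \<Rightarrow> h i * \<phi> v"
proof -
  fix h :: "'i \<Rightarrow> complex" and \<phi> :: "'i list \<Rightarrow> complex"
  assume "(\<lambda>j. (cmod (h j))\<^sup>2) summable_on UNIV" "(\<lambda>j. (cmod (\<phi> j))\<^sup>2) summable_on UNIV"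
  then have "ell2_coeff (Abs_ell2 h) = h" "ell2_coeff (Abs_ell2 \<phi>) = \<phi>"
    by (simp_all add: Abs_ell2_inverse)
  then show "(\<lambda>w. (cmod (case w of [] \<Rightarrow> 0 | i # v \<Rightarrow> h i * \<phi> v))\<^sup>2) summable_on UNIV"
    using has_sum_imp_summable[OF fock_tensor_has_sum[of "Abs_ell2 h" "Abs_ell2 \<phi>"]]
    by (simp only:)
qed

lemma norm_fock_tensor: "norm (fock_tensor h \<phi>) = norm h * norm \<phi>"
proof -
  have "(norm (fock_tensor h \<phi>))\<^sup>2 = (norm h)\<^sup>2 * (norm \<phi>)\<^sup>2"
    unfolding norm_ell2[of "fock_tensor h \<phi>"] fock_tensor.rep_eq
    by (rule infsumI[OF fock_tensor_has_sum])
  then show ?thesis by (simp flip: power_mult_distrib)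
qed

lift_definition left_creation :: "'i \<Rightarrow> ('i fock \<Rightarrow>\<^sub>L 'i fock)" is
  "\<lambda>i \<phi>. fock_tensor (ell2_basis i) \<phi>"
proof (rule bounded_linear_intro)
  fix i :: 'i and \<phi> \<psi> :: "'i fock" and r :: real
  show "fock_tensor (ell2_basis i) (\<phi> + \<psi>)
      = fock_tensor (ell2_basis i) \<phi> + fock_tensor (ell2_basis i) \<psi>"
    by transfer (auto simp: fun_eq_iff algebra_simps split: list.splits)
  show "fock_tensor (ell2_basis i) (r *\<^sub>R \<phi>) = r *\<^sub>R fock_tensor (ell2_basis i) \<phi>"
    unfolding scaleR_ell2_def by transfer (auto simp: fun_eq_iff split: list.splits)
  show "norm (fock_tensor (ell2_basis i) \<phi>) \<le> norm \<phi> * norm (ell2_basis i)"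
    by (simp add: norm_fock_tensor mult.commute)
qed

lemma left_creation_bounded_ops: "left_creation i \<in> bounded_ops"
  by (auto intro!: ell2_eqI simp: bounded_ops_def left_creation.rep_eq fock_tensor.rep_eq scaleC_ell2.rep_eq split: list.splits)

end

theory Submission
  imports Defs
begin

text \<open>The classical proof of the Borel-Caratheodory inequality bounds each Taylor coefficient of a
  function by the excess of an upper bound for its real part over the real part of its constant
  term, and then sums a geometric series. The same works for a free power series, because the part
  of degree \<open>k\<close> of such a series has one number that controls it on all operator tuples: the norm
  \<open>c\<^sub>k\<close> of the column formed by its coefficients \<open>A w\<close>, where \<open>length w = k\<close>.

  On the one hand, the sum of the \<open>X\<^sub>w \<otimes> A w\<close> is the row of the \<open>X\<^sub>w \<otimes> I\<close> times the column of the
  \<open>I \<otimes> A w\<close>. The row has norm at most \<open>r\<^sup>k\<close> if \<open>X\<close> has row norm \<open>r\<close>, so the part of degree \<open>k\<close>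
  is at most \<open>r\<^sup>k c\<^sub>k\<close> in norm (\<open>homogeneous_part_estimate\<close>).

  On the other hand, write \<open>T\<close> for the value of the series at \<open>\<gamma> S\<close>. It sends the vector
  \<open>e \<otimes> x\<close>, where \<open>e\<close> is the vacuum, to the sum of the orthogonal vectors
  \<open>\<gamma>\<^sup>k e\<^sub>w \<otimes> A w x\<close> with \<open>k = length w\<close>, so that the vacuum sees the columns. Moreover \<open>T\<close> never
  lowers the degree. Testing the inequality \<open>Re \<langle>T y, y\<rangle> \<le> A\<^sub>\<gamma> \<parallel>y\<parallel>\<^sup>2\<close> on
  sums of a vector of degree \<open>0\<close> and a vector of degree \<open>k\<close> therefore gives
  \<open>\<gamma>\<^sup>k c\<^sub>k \<le> 2 (A\<^sub>\<gamma> + \<parallel>A []\<parallel>)\<close> for \<open>k > 0\<close> (\<open>column_le_real_part_bound\<close>). As the norm of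
  \<open>A []\<close> is that of \<open>F 0\<close>, summing over \<open>k\<close> yields
  \<open>\<parallel>F X\<parallel> \<le> \<parallel>F 0\<parallel> + 2 (A\<^sub>\<gamma> + \<parallel>F 0\<parallel>) r / (\<gamma> - r)\<close>, which is the claim.

  The series is only given on the Hilbert space \<open>'h\<close>, and its convergence at \<open>\<gamma> S\<close> has to be
  derived. An infinite dimensional Hilbert space contains an isometric copy of the Fock space, hence
  a copy of \<open>\<sigma> S\<close> with \<open>\<gamma> < \<sigma> < s\<close>. There the parts of the series are bounded, which bounds
  \<open>\<sigma>\<^sup>k c\<^sub>k\<close> (\<open>free_holomorphic_column_bound\<close>), and so the series at \<open>\<gamma> S\<close> is dominated by a
  geometric series.\<close>


section \<open>Complex inner products\<close>

lemma cinner_add_right: "cinner x (y + z) = cinner x y + cinner x (z :: 'a::complex_inner)"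
  by (metis cinner_commute cinner_add_left complex_cnj_add)

lemma cinner_scaleC_right: "cinner x (a *\<^sub>C y) = cnj a * cinner x (y :: 'a::complex_inner)"
  by (metis cinner_commute cinner_scaleC_left complex_cnj_mult)

lemma cinner_scaleR_left: "cinner (r *\<^sub>R x) y = of_real r * cinner x (y :: 'a::complex_inner)"
  by (simp add: scaleR_scaleC cinner_scaleC_left)

lemma cinner_scaleR_right: "cinner x (r *\<^sub>R y) = of_real r * cinner x (y :: 'a::complex_inner)"
  by (simp add: scaleR_scaleC cinner_scaleC_right)

lemma additive_cinner_left: "Modules.additive (\<lambda>x :: 'a::complex_inner. cinner x y)"
  by (simp add: Modules.additive_def cinner_add_left)

lemma additive_cinner_right: "Modules.additive (\<lambda>y :: 'a::complex_inner. cinner x y)"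
  by (simp add: Modules.additive_def cinner_add_right)

lemmas cinner_zero_left [simp] = Modules.additive.zero[OF additive_cinner_left]
lemmas cinner_zero_right [simp] = Modules.additive.zero[OF additive_cinner_right]
lemmas cinner_diff_left = Modules.additive.diff[OF additive_cinner_left]
lemmas cinner_diff_right = Modules.additive.diff[OF additive_cinner_right]
lemmas cinner_sum_left = Modules.additive.sum[OF additive_cinner_left]
lemmas cinner_sum_right = Modules.additive.sum[OF additive_cinner_right]

lemma cinner_self: "cinner x x = complex_of_real ((norm (x :: 'a::complex_inner))\<^sup>2)"
proof (rule complex_eqI)
  show "Re (cinner x x) = Re (complex_of_real ((norm x)\<^sup>2))"
    by (simp add: power2_norm_eq_inner inner_eq_Re_cinner)
  have "Im (cinner x x) = - Im (cinner x x)"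
    using arg_cong[OF cinner_commute[of x x], of Im] by simp
  then show "Im (cinner x x) = Im (complex_of_real ((norm x)\<^sup>2))" by simp
qed

lemma Re_cinner_commute: "Re (cinner x y) = Re (cinner y (x :: 'a::complex_inner))"
  by (subst cinner_commute) simp

lemma cinner_eq_inner:
  "cinner x y = Complex (inner x y) (inner x (\<i> *\<^sub>C (y :: 'a::complex_inner)))"
  by (rule complex_eqI) (simp_all add: inner_eq_Re_cinner cinner_scaleC_right)

lemma norm_scaleC: "norm (c *\<^sub>C x) = cmod c * norm (x :: 'a::complex_inner)"
proof -
  have "complex_of_real ((norm (c *\<^sub>C x))\<^sup>2) = complex_of_real ((cmod c * norm x)\<^sup>2)"
    unfolding cinner_self[symmetric] cinner_scaleC_left cinner_scaleC_right
    unfolding cinner_self power_mult_distrib of_real_mult complex_norm_square by simp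
  then have "(norm (c *\<^sub>C x))\<^sup>2 = (cmod c * norm x)\<^sup>2" by (simp only: of_real_eq_iff)
  then show ?thesis by (simp add: power2_eq_iff_nonneg)
qed

lemma norm_cinner_le: "cmod (cinner x y) \<le> norm x * norm (y :: 'a::complex_inner)"
proof (cases "cinner x y = 0")
  case False
  define c where "c = cnj (cinner x y) / of_real (cmod (cinner x y))"
  have c: "cmod c = 1" using False by (simp add: c_def norm_divide)
  have "cinner (c *\<^sub>C x) y = of_real (cmod (cinner x y))"
    using False unfolding cinner_scaleC_left c_def
    by (simp add: field_simps flip: complex_norm_square) (simp add: power2_eq_square)
  then have "cmod (cinner x y) = inner (c *\<^sub>C x) y" by (simp add: inner_eq_Re_cinner)
  also have "\<dots> \<le> norm (c *\<^sub>C x) * norm y" by (rule norm_cauchy_schwarz)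
  finally show ?thesis by (simp add: norm_scaleC c)
qed simp

lemma Re_cinner_ge:
  fixes x y :: "'a::complex_inner"
  assumes "norm x \<le> b * norm y"
  shows "- (b * (norm y)\<^sup>2) \<le> Re (cinner x y)"
proof -
  have "- Re (cinner x y) \<le> cmod (cinner x y)"
    using abs_Re_le_cmod[of "cinner x y"] by linarith
  also have "\<dots> \<le> norm x * norm y" by (rule norm_cinner_le)
  also have "\<dots> \<le> b * norm y * norm y" by (intro mult_right_mono assms) auto
  finally show ?thesis by (simp add: power2_eq_square mult.assoc)
qed

lemma bounded_linear_scaleC: "bounded_linear (\<lambda>x :: 'a::complex_inner. c *\<^sub>C x)"
  by (rule bounded_linear_intro[where K = "cmod c"])
    (simp_all add: scaleC_add_right scaleR_scaleC scaleC_scaleC norm_scaleC mult.commute)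

lemma bounded_linear_cinner_left: "bounded_linear (\<lambda>x :: 'a::complex_inner. cinner x y)"
  by (rule bounded_linear_intro[where K = "norm y"])
    (simp_all add: cinner_add_left cinner_scaleR_left norm_cinner_le scaleR_conv_of_real)

lemma cinner_eqI: "(\<And>y. cinner x y = cinner x' y) \<Longrightarrow> x = (x' :: 'a::complex_inner)"
  by (metis cinner_diff_left cinner_self diff_self norm_eq_zero of_real_eq_0_iff
      power2_eq_iff_nonneg right_minus_eq zero_eq_power2)


section \<open>Riesz representation and adjoints\<close>

text \<open>A nonzero functional attains its norm: unit vectors \<open>x\<^sub>n\<close> along which it tends to its norm
  form a Cauchy sequence, because the parallelogram law turns \<open>norm (x\<^sub>n + x\<^sub>m) \<rightarrow> 2\<close> into
  \<open>norm (x\<^sub>n - x\<^sub>m) \<rightarrow> 0\<close>.\<close>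

lemma functional_attains_norm:
  fixes f :: "'a::{real_inner, complete_space} \<Rightarrow>\<^sub>L real"
  assumes "f \<noteq> 0"
  shows "\<exists>x. norm x = 1 \<and> f x = norm f"
proof -
  define N where "N = norm f"
  have N: "N > 0" using assms by (simp add: N_def)
  have le: "f x \<le> N * norm x" for x
    using norm_blinfun[of f x] by (simp add: N_def)
  have "\<exists>x. norm x = 1 \<and> f x > N * (1 - e)" if "e > 0" for e
  proof (rule ccontr)
    assume not: "\<not> ?thesis"
    then have unit: "f x \<le> N * (1 - e)" if "norm x = 1" for x using that not_less by blast
    have ne: "\<exists>x. norm (x :: 'a) = 1"
    proof -
      obtain x where "f x \<noteq> 0" using assms by (metis blinfun_eqI zero_blinfun.rep_eq)
      then have "x \<noteq> 0" by auto
      then show ?thesis by (intro exI[of _ "sgn x"]) (simp add: norm_sgn)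
    qed
    have "norm (f x) \<le> N * (1 - e) * norm x" for x
    proof (cases "x = 0")
      case False
      have "\<bar>f x\<bar> = max (f x) (f (- x))" by (simp add: blinfun.minus_right)
      moreover have scaled: "f x \<le> N * (1 - e) * norm x" if "x \<noteq> 0" for x
        using unit[of "sgn x"] that
        by (simp add: norm_sgn sgn_div_norm blinfun.scaleR_right field_simps)
      ultimately show ?thesis
        using False scaled[of x] scaled[of "- x"] by (simp add: max_def)
    qed simp
    moreover have "0 \<le> N * (1 - e)"
    proof -
      obtain x :: 'a where x: "norm x = 1" using ne by blast
      then show ?thesis using unit[of x] unit[of "- x"] by (simp add: blinfun.minus_right)
    qed
    ultimately have "norm f \<le> N * (1 - e)" by (intro norm_blinfun_bound) auto
    then show False using mult_pos_pos[OF N \<open>e > 0\<close>] by (simp add: algebra_simps flip: N_def)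
  qed
  then have "\<forall>n. \<exists>x. norm x = 1 \<and> f x > N * (1 - inverse (real (Suc n)))" by simp
  then obtain X where X: "\<And>n. norm (X n) = 1" "\<And>n. f (X n) > N * (1 - inverse (real (Suc n)))"
    by metis
  have dist: "(norm (X m - X n))\<^sup>2 \<le> 8 * inverse (real (Suc k))" if "m \<ge> k" "n \<ge> k" for m n k
  proof -
    define d where "d = inverse (real (Suc k))"
    have d: "0 < d" "d \<le> 1" by (simp_all add: d_def field_simps)
    have "N * (1 - d) \<le> N * (1 - inverse (real (Suc l)))" if "l \<ge> k" for l
      using N that unfolding d_def by (intro mult_left_mono) auto
    then have "N * (2 * (1 - d)) \<le> f (X m + X n)"
      using X(2)[of m] X(2)[of n] that
      by (simp add: blinfun.add_right) (smt (verit, best) distrib_left)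
    also have "\<dots> \<le> N * norm (X m + X n)" by (rule le)
    finally have "2 * (1 - d) \<le> norm (X m + X n)" using N by simp
    then have "(2 * (1 - d))\<^sup>2 \<le> (norm (X m + X n))\<^sup>2" using d by (intro power_mono) auto
    moreover have "(norm (X m - X n))\<^sup>2 + (norm (X m + X n))\<^sup>2 = 4"
    proof -
      have "(norm (X m - X n))\<^sup>2 + (norm (X m + X n))\<^sup>2 = 2 * (norm (X m))\<^sup>2 + 2 * (norm (X n))\<^sup>2"
        by (simp add: power2_norm_eq_inner inner_add inner_diff inner_commute algebra_simps)
      then show ?thesis using X(1) by simp
    qed
    ultimately have "(norm (X m - X n))\<^sup>2 \<le> 8 * d - 4 * d\<^sup>2"
      by (simp add: power2_eq_square algebra_simps)
    then show ?thesis by (simp add: d_def) (smt (verit) zero_le_power2)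
  qed
  have "Cauchy X"
  proof (rule CauchyI)
    fix e :: real assume "e > 0"
    then have "e\<^sup>2 / 8 > 0" by simp
    then obtain k where k: "inverse (real (Suc k)) < e\<^sup>2 / 8" using reals_Archimedean by blast
    have "norm (X m - X n) < e" if "m \<ge> k" "n \<ge> k" for m n
    proof -
      have "(norm (X m - X n))\<^sup>2 < e\<^sup>2" using dist[OF that] k by simp
      then show ?thesis using \<open>e > 0\<close> by (simp add: power2_less_imp_less)
    qed
    then show "\<exists>k. \<forall>m\<ge>k. \<forall>n\<ge>k. norm (X m - X n) < e" by blast
  qed
  then obtain x where x: "X \<longlonglongrightarrow> x" using Cauchy_convergent convergent_def by blast
  have "norm x = 1" using tendsto_norm[OF x] X(1) by (simp add: LIMSEQ_const_iff)
  moreover have "f x \<ge> N"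
  proof (rule LIMSEQ_le)
    show "(\<lambda>n. f (X n)) \<longlonglongrightarrow> f x" by (intro tendsto_intros x)
    show "(\<lambda>n. N * (1 - inverse (real (Suc n)))) \<longlonglongrightarrow> N"
      using tendsto_mult_left[OF tendsto_diff[OF tendsto_const LIMSEQ_inverse_real_of_nat], of N 1]
      by simp
    show "\<exists>N'. \<forall>n\<ge>N'. N * (1 - inverse (real (Suc n))) \<le> f (X n)"
      using X(2) less_imp_le by blast
  qed
  ultimately show ?thesis using le[of x] by (auto simp: N_def intro: antisym)
qed

lemma Riesz_representation:
  fixes f :: "'a::{real_inner, complete_space} \<Rightarrow>\<^sub>L real"
  shows "\<exists>z. \<forall>x. f x = inner x z"
proof (cases "f = 0")
  case True
  then show ?thesis by (intro exI[of _ 0]) simp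
next
  case False
  then obtain u where u: "norm u = 1" "f u = norm f" using functional_attains_norm by blast
  have orth: "f x = 0" if "inner x u = 0" for x
  proof (rule ccontr)
    assume nz: "f x \<noteq> 0"
    \<comment> \<open>moving from the maximizer \<open>u\<close> along \<open>x\<close> changes the norm only to second order\<close>
    define t where "t = norm f * f x / ((norm f)\<^sup>2 * ((norm x)\<^sup>2 + 1))"
    have N: "norm f > 0" using False by simp
    have "(f (u + t *\<^sub>R x))\<^sup>2 \<le> (norm f)\<^sup>2 * (norm (u + t *\<^sub>R x))\<^sup>2"
      using norm_blinfun[of f "u + t *\<^sub>R x"]
      by (metis abs_ge_zero power2_abs power_mono power_mult_distrib real_norm_def)
    moreover have "(norm (u + t *\<^sub>R x))\<^sup>2 = 1 + t\<^sup>2 * (norm x)\<^sup>2"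
    proof -
      have "inner u x = 0" "inner u u = 1"
        using that u by (simp_all add: inner_commute norm_eq_1)
      then show ?thesis
        using that by (simp add: power2_norm_eq_inner inner_add_left inner_add_right)
          (simp add: power2_eq_square)
    qed
    ultimately have "(norm f + t * f x)\<^sup>2 \<le> (norm f)\<^sup>2 * (1 + t\<^sup>2 * (norm x)\<^sup>2)"
      by (simp add: blinfun.add_right blinfun.scaleR_right u)
    then have "2 * norm f * (t * f x) + (t * f x)\<^sup>2 \<le> (norm f)\<^sup>2 * (t\<^sup>2 * (norm x)\<^sup>2)"
      by (simp add: power2_eq_square algebra_simps)
    moreover have "(norm f)\<^sup>2 * (t\<^sup>2 * (norm x)\<^sup>2) \<le> t * (norm f * f x)"
    proof -
      have pos: "0 < (norm f)\<^sup>2 * ((norm x)\<^sup>2 + 1)"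
        using N by (simp add: add_nonneg_pos)
      then have "norm f * f x = t * ((norm f)\<^sup>2 * ((norm x)\<^sup>2 + 1))"
        by (metis less_irrefl nonzero_eq_divide_eq t_def)
      moreover have "0 \<le> (t * norm f)\<^sup>2" by simp
      ultimately show ?thesis by (simp add: power2_eq_square algebra_simps)
    qed
    moreover have "t * f x > 0"
    proof -
      have "t * f x = norm f * (f x)\<^sup>2 / ((norm f)\<^sup>2 * ((norm x)\<^sup>2 + 1))"
        by (simp add: t_def power2_eq_square)
      also have "\<dots> > 0" using N nz by (intro divide_pos_pos mult_pos_pos) (auto simp: add_nonneg_pos)
      finally show ?thesis .
    qed
    moreover from this have "0 < norm f * (t * f x)" using N by simp
    moreover have "t * (norm f * f x) = norm f * (t * f x)" by simp
    moreover have "0 \<le> (t * f x)\<^sup>2" by simp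
    ultimately show False by linarith
  qed
  show ?thesis
  proof (intro exI allI)
    fix x
    have "inner (x - inner x u *\<^sub>R u) u = 0"
      using u by (simp add: inner_diff_left norm_eq_1)
    then have "f (x - inner x u *\<^sub>R u) = 0" by (rule orth)
    then show "f x = inner x (norm f *\<^sub>R u)"
      by (simp add: blinfun.diff_right blinfun.scaleR_right u)
  qed
qed

lemma bounded_opsD: "T \<in> bounded_ops \<Longrightarrow> blinfun_apply T (c *\<^sub>C x) = c *\<^sub>C blinfun_apply T x"
  by (simp add: bounded_ops_def)

text \<open>The real adjoint, obtained from the real inner product by the Riesz representation, is also
  the complex one: multiplication by \<open>\<i>\<close> is skew for the real inner product, so the adjoint of a
  complex linear map commutes with it.\<close>

lemma adjoint_exists:
  fixes T :: "'a::chilbert_space \<Rightarrow>\<^sub>L 'b::chilbert_space"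
  assumes T: "T \<in> bounded_ops"
  shows "\<exists>S. S \<in> bounded_ops \<and> (\<forall>x y. cinner (T x) y = cinner x (blinfun_apply S y))"
proof -
  have "\<exists>z. \<forall>x. inner (T x) y = inner x z" for y
  proof -
    have "bounded_linear (\<lambda>x. inner (T x) y)"
      by (intro bounded_linear_compose[OF bounded_linear_inner_left] blinfun.bounded_linear_right)
    then show ?thesis using Riesz_representation[of "Blinfun (\<lambda>x. inner (T x) y)"]
      by (simp add: bounded_linear_Blinfun_apply)
  qed
  then obtain g where g: "\<And>x y. inner (T x) y = inner x (g y)" by metis
  have ext: "z = z'" if "\<And>x. inner x z = inner x z'" for z z' :: 'a
    using that[of "z - z'"] by (metis inner_diff_right inner_eq_zero_iff right_minus_eq)
  have iC: "inner x (c *\<^sub>C y) = inner (cnj c *\<^sub>C x) y" for x y :: "'z::complex_inner" and c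
    by (simp add: inner_eq_Re_cinner cinner_scaleC_left cinner_scaleC_right)
  have "bounded_linear g"
  proof (rule bounded_linear_intro)
    fix y z r
    show "g (y + z) = g y + g z" by (rule ext) (simp add: inner_add_right flip: g)
    show "g (r *\<^sub>R y) = r *\<^sub>R g y" by (rule ext) (simp flip: g)
    have "(norm (g y))\<^sup>2 \<le> norm (T (g y)) * norm y"
      unfolding power2_norm_eq_inner g[symmetric] by (rule norm_cauchy_schwarz)
    also have "\<dots> \<le> norm (g y) * (norm y * norm T)"
      using mult_right_mono[OF norm_blinfun[of T "g y"], of "norm y"] by (simp add: mult_ac)
    finally show "norm (g y) \<le> norm y * norm T"
      by (cases "norm (g y) = 0") (auto simp: power2_eq_square)
  qed
  moreover have "g (c *\<^sub>C y) = c *\<^sub>C g y" for c y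
    by (rule ext) (simp add: iC bounded_opsD[OF T] flip: g)
  moreover have "cinner (T x) y = cinner x (g y)" for x y
    unfolding cinner_eq_inner g by (simp add: iC flip: g) (simp add: bounded_opsD[OF T] blinfun.minus_right)
  ultimately show ?thesis
    by (intro exI[of _ "Blinfun g"]) (simp add: bounded_ops_def bounded_linear_Blinfun_apply)
qed

lemma cadjoint_eqI:
  fixes T :: "'a::chilbert_space \<Rightarrow>\<^sub>L 'b::chilbert_space"
  assumes "S \<in> bounded_ops" "\<And>x y. cinner (T x) y = cinner x (blinfun_apply S y)"
  shows "cadjoint T = S"
  unfolding cadjoint_def
proof (rule the_equality)
  fix S' :: "'b \<Rightarrow>\<^sub>L 'a"
  assume S': "S' \<in> bounded_ops \<and> (\<forall>x y. cinner (blinfun_apply T x) y = cinner x (blinfun_apply S' y))"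
  show "S' = S"
  proof (intro blinfun_eqI cinner_eqI)
    fix y x
    have "cinner x (S' y) = cinner x (S y)" using S' assms(2)[of x y] by simp
    then show "cinner (S' y) x = cinner (S y) x"
      using cinner_commute[of "S' y" x] cinner_commute[of "S y" x] by simp
  qed
qed (use assms in auto)

lemma
  fixes T :: "'a::chilbert_space \<Rightarrow>\<^sub>L 'b::chilbert_space"
  assumes T: "T \<in> bounded_ops"
  shows cadjoint_bounded_ops: "cadjoint T \<in> bounded_ops"
    and cinner_cadjoint: "cinner (T x) y = cinner x (cadjoint T y)"
proof -
  obtain S where S: "S \<in> bounded_ops" "\<And>x y. cinner (T x) y = cinner x (blinfun_apply S y)"
    using adjoint_exists[OF T] by blast
  have "cadjoint T = S" by (rule cadjoint_eqI) (use S in auto)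
  then show "cadjoint T \<in> bounded_ops" "cinner (T x) y = cinner x (cadjoint T y)"
    using S by auto
qed

lemma cinner_cadjoint': 
  "T \<in> bounded_ops \<Longrightarrow> cinner x (blinfun_apply T y) = cinner (cadjoint T x) y"
  by (subst (1 2) cinner_commute) (simp add: cinner_cadjoint)

lemma bounded_ops_compose: "S \<in> bounded_ops \<Longrightarrow> T \<in> bounded_ops \<Longrightarrow> S o\<^sub>L T \<in> bounded_ops"
  by (simp add: bounded_ops_def)

lemma bounded_ops_scaleR: "T \<in> bounded_ops \<Longrightarrow> r *\<^sub>R T \<in> bounded_ops"
  by (simp add: bounded_ops_def blinfun.scaleR_left scaleR_scaleC scaleC_scaleC mult.commute)

lemma bounded_ops_id: "id_blinfun \<in> bounded_ops"
  by (simp add: bounded_ops_def)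

lemma cadjoint_compose:
  "S \<in> bounded_ops \<Longrightarrow> T \<in> bounded_ops \<Longrightarrow> cadjoint (S o\<^sub>L T) = cadjoint T o\<^sub>L cadjoint S"
  by (rule cadjoint_eqI) (simp_all add: bounded_ops_compose cadjoint_bounded_ops cinner_cadjoint)

lemma cadjoint_scaleR: "T \<in> bounded_ops \<Longrightarrow> cadjoint (r *\<^sub>R T) = r *\<^sub>R cadjoint T"
  by (rule cadjoint_eqI) (simp_all add: bounded_ops_scaleR cadjoint_bounded_ops cinner_cadjoint
      blinfun.scaleR_left cinner_scaleR_left cinner_scaleR_right)

lemma cadjoint_id: "cadjoint id_blinfun = id_blinfun"
  by (rule cadjoint_eqI) (simp_all add: bounded_ops_id)

lemma cadjoint_cadjoint: "T \<in> bounded_ops \<Longrightarrow> cadjoint (cadjoint T) = T"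
  by (rule cadjoint_eqI) (simp_all add: cinner_cadjoint')

lemma Re_cinner_real_part:
  assumes "T \<in> bounded_ops"
  shows "Re (cinner (real_part T y) y) = Re (cinner (blinfun_apply T y) y)"
proof -
  have "Re (cinner (cadjoint T y) y) = Re (cinner (T y) y)"
    unfolding cinner_cadjoint[OF assms] by (rule Re_cinner_commute)
  then show ?thesis
    by (simp add: real_part_def blinfun.scaleR_left blinfun.add_left cinner_scaleR_left
        cinner_add_left)
qed


section \<open>Orthonormal families\<close>

lemma norm_eq_1_cinner:
  assumes "cinner x x = 1"
  shows "norm (x :: 'a::complex_inner) = 1"
proof -
  have "(norm x)\<^sup>2 = 1" using assms unfolding cinner_self by (simp only: of_real_eq_1_iff)
  then show ?thesis using norm_ge_zero[of x] by (auto simp: power2_eq_1_iff)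
qed

definition orthonormal_on :: "'j set \<Rightarrow> ('j \<Rightarrow> 'a::complex_inner) \<Rightarrow> bool" where
  "orthonormal_on J h \<longleftrightarrow> (\<forall>i\<in>J. \<forall>j\<in>J. cinner (h i) (h j) = (if i = j then 1 else 0))"

lemma norm_sum_orthogonal:
  fixes v :: "'j \<Rightarrow> 'a::complex_inner"
  assumes "finite J" "\<And>i j. i \<in> J \<Longrightarrow> j \<in> J \<Longrightarrow> i \<noteq> j \<Longrightarrow> cinner (v i) (v j) = 0"
  shows "(norm (\<Sum>j\<in>J. v j))\<^sup>2 = (\<Sum>j\<in>J. (norm (v j))\<^sup>2)"
proof -
  have "complex_of_real ((norm (\<Sum>j\<in>J. v j))\<^sup>2) = (\<Sum>i\<in>J. \<Sum>j\<in>J. cinner (v i) (v j))"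
    by (subst cinner_self[symmetric]) (simp only: cinner_sum_left cinner_sum_right, rule sum.swap)
  also have "\<dots> = (\<Sum>i\<in>J. \<Sum>j\<in>J. if i = j then cinner (v i) (v i) else 0)"
    using assms(2) by (intro sum.cong) auto
  also have "\<dots> = of_real (\<Sum>j\<in>J. (norm (v j))\<^sup>2)"
    using assms(1) by (simp add: cinner_self)
  finally show ?thesis by (simp only: of_real_eq_iff)
qed

lemma orthogonal_projection_residue:
  assumes "finite J" "orthonormal_on J h" "j \<in> J"
  shows "cinner (y - (\<Sum>i\<in>J. cinner y (h i) *\<^sub>C h i)) (h j) = 0"
proof -
  have "(\<Sum>i\<in>J. cinner y (h i) * cinner (h i) (h j)) = (\<Sum>i\<in>J. if i = j then cinner y (h j) else 0)"
    using assms by (intro sum.cong) (auto simp: orthonormal_on_def)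
  then show ?thesis
    using assms by (simp add: cinner_diff_left cinner_sum_left cinner_scaleC_left)
qed

lemma Bessel_inequality:
  assumes "finite J" "orthonormal_on J h"
  shows "(\<Sum>j\<in>J. (cmod (cinner y (h j)))\<^sup>2) \<le> (norm y)\<^sup>2"
proof -
  define p where "p = (\<Sum>i\<in>J. cinner y (h i) *\<^sub>C h i)"
  have nh: "norm (h j) = 1" if "j \<in> J" for j
  using assms(2) that by (intro norm_eq_1_cinner) (simp add: orthonormal_on_def)
  have "(norm p)\<^sup>2 = (\<Sum>j\<in>J. (norm (cinner y (h j) *\<^sub>C h j))\<^sup>2)"
    unfolding p_def using assms
    by (intro norm_sum_orthogonal)
      (auto simp: orthonormal_on_def cinner_scaleC_left cinner_scaleC_right)
  also have "\<dots> = (\<Sum>j\<in>J. (cmod (cinner y (h j)))\<^sup>2)"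
    by (intro sum.cong) (auto simp: norm_scaleC nh)
  finally have p: "(norm p)\<^sup>2 = (\<Sum>j\<in>J. (cmod (cinner y (h j)))\<^sup>2)" .
  have "cinner (y - p) p = 0"
    unfolding p_def[THEN arg_cong, of "cinner (y - p)"] cinner_sum_right cinner_scaleC_right
    using orthogonal_projection_residue[OF assms, of _ y] by (simp add: p_def)
  then have "cinner p (y - p) = 0" by (metis cinner_commute complex_cnj_zero)
  have "(norm y)\<^sup>2 = (norm (y - p))\<^sup>2 + (norm p)\<^sup>2"
  proof -
    have "complex_of_real ((norm y)\<^sup>2) = cinner ((y - p) + p) ((y - p) + p)"
      by (simp add: cinner_self)
    also have "\<dots> = cinner (y - p) (y - p) + cinner p p"
      unfolding cinner_add_left cinner_add_right
      using \<open>cinner (y - p) p = 0\<close> \<open>cinner p (y - p) = 0\<close> by simp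
    finally show ?thesis unfolding cinner_self by (simp only: of_real_eq_iff flip: of_real_add)
  qed
  then show ?thesis using p by simp
qed

lemma cinner_sgn_self: "x \<noteq> 0 \<Longrightarrow> cinner (sgn x) (sgn (x :: 'a::complex_inner)) = 1"
  by (simp add: cinner_self norm_sgn)

text \<open>Finitely many vectors are expanded in a common finite orthonormal system; in sums of
  elementary tensors this replaces one of the two factors by orthonormal vectors.\<close>

lemma Gram_Schmidt:
  assumes "finite (S :: 'a::complex_inner set)"
  shows "\<exists>B. finite B \<and> orthonormal_on B (\<lambda>b. b) \<and> (\<forall>y\<in>S. y = (\<Sum>b\<in>B. cinner y b *\<^sub>C b))"
  using assms
proof (induction S)
  case empty
  show ?case by (rule exI[of _ "{}"]) (simp add: orthonormal_on_def)
next
  case (insert y S)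
  then obtain B where B: "finite B" "orthonormal_on B (\<lambda>b. b)"
    "\<And>x. x \<in> S \<Longrightarrow> x = (\<Sum>b\<in>B. cinner x b *\<^sub>C b)" by blast
  define p where "p = y - (\<Sum>b\<in>B. cinner y b *\<^sub>C b)"
  have p: "cinner p b = 0" "cinner b p = 0" if "b \<in> B" for b
    using orthogonal_projection_residue[OF B(1,2) that, of y]
    by (auto simp: p_def) (metis cinner_commute complex_cnj_zero)
  show ?case
  proof (cases "p = 0")
    case True
    then show ?thesis using B by (intro exI[of _ B]) (auto simp: p_def)
  next
    case False
    have sgn: "cinner (sgn p) b = 0" "cinner b (sgn p) = 0" if "b \<in> B" for b
      using p[OF that] by (simp_all add: sgn_div_norm cinner_scaleR_left cinner_scaleR_right)
    then have notin: "sgn p \<notin> B"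
      using cinner_sgn_self[OF False] by fastforce
    have "orthonormal_on (insert (sgn p) B) (\<lambda>b. b)"
      using B(2) sgn cinner_sgn_self[OF False] by (auto simp: orthonormal_on_def)
    moreover have "x = (\<Sum>b\<in>insert (sgn p) B. cinner x b *\<^sub>C b)" if "x \<in> S" for x
    proof -
      have "cinner x (sgn p) = cinner (\<Sum>b\<in>B. cinner x b *\<^sub>C b) (sgn p)"
        using B(3)[OF that] by simp
      also have "\<dots> = 0"
        by (simp add: cinner_sum_left cinner_scaleC_left sgn)
      finally show ?thesis using B(1,3) notin that by simp
    qed
    moreover have "y = (\<Sum>b\<in>insert (sgn p) B. cinner y b *\<^sub>C b)"
    proof -
      have "y = p + (\<Sum>b\<in>B. cinner y b *\<^sub>C b)" by (simp add: p_def)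
      then have "cinner y (sgn p) = cinner (p + (\<Sum>b\<in>B. cinner y b *\<^sub>C b)) (sgn p)" by simp
      also have "\<dots> = cinner p (sgn p)"
        by (simp add: cinner_add_left cinner_sum_left cinner_scaleC_left sgn)
      also have "\<dots> = of_real (norm p)"
        using False by (simp add: sgn_div_norm cinner_scaleR_right cinner_self power2_eq_square)
      finally have "cinner y (sgn p) *\<^sub>C sgn p = p"
        using False by (simp add: sgn_div_norm flip: scaleR_scaleC)
      then show ?thesis using B(1) notin by (simp add: p_def)
    qed
    ultimately show ?thesis using B(1) by (intro exI[of _ "insert (sgn p) B"]) auto
  qed
qed

lemma infinite_dimensional_orthonormal_sequence:
  assumes "infinite_dimensional TYPE('a::complex_inner)"
  shows "\<exists>h :: nat \<Rightarrow> 'a. orthonormal_on UNIV h"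
proof -
  define P where "P f n x \<longleftrightarrow> cinner x x = 1 \<and> (\<forall>m<n. cinner x (f m) = 0)"
    for f :: "nat \<Rightarrow> 'a" and n x
  have "\<exists>f. \<forall>n. P f n (f n)"
  proof (rule dependent_wellorder_choice)
    show "P f n x = P g n x" if "\<And>m. m < n \<Longrightarrow> f m = g m" for x f g n
      using that by (simp add: P_def)
    fix n f assume IH: "\<And>m. m < n \<Longrightarrow> P f m (f m)"
    have on: "orthonormal_on {..<n} f"
      unfolding orthonormal_on_def
    proof (intro ballI)
      fix i j assume "i \<in> {..<n}" "j \<in> {..<n}"
      then have "P f i (f i)" "P f j (f j)" using IH by auto
      then show "cinner (f i) (f j) = (if i = j then 1 else 0)"
        unfolding P_def using cinner_commute[of "f i" "f j"]
        by (cases i j rule: linorder_cases) auto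
    qed
    obtain y where y: "y \<notin> cspan (f ` {..<n})"
      using assms unfolding infinite_dimensional_def by blast
    define p where "p = y - (\<Sum>i<n. cinner y (f i) *\<^sub>C f i)"
    have "(\<Sum>i<n. cinner y (f i) *\<^sub>C f i) \<in> cspan (f ` {..<n})"
      by (intro complex_vector.span_sum complex_vector.span_scale complex_vector.span_base) auto
    then have "p \<noteq> 0" using y by (auto simp: p_def)
    moreover have "cinner p (f m) = 0" if "m < n" for m
      unfolding p_def using orthogonal_projection_residue[OF _ on, of m y] that by simp
    ultimately have "P f n (sgn p)"
      unfolding P_def by (simp add: cinner_sgn_self) (simp add: sgn_div_norm cinner_scaleR_left)
    then show "\<exists>x. P f n x" by blast
  qed
  then obtain f where f: "\<And>n. P f n (f n)" by blast
  have "orthonormal_on UNIV f"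
    unfolding orthonormal_on_def
  proof (intro ballI)
    fix i j
    show "cinner (f i) (f j) = (if i = j then 1 else 0)"
      using f[of i] f[of j] cinner_commute[of "f i" "f j"] unfolding P_def
      by (cases i j rule: linorder_cases) auto
  qed
  then show ?thesis by blast
qed


section \<open>Operators on tensor products\<close>

instance chilbert_space \<subseteq> banach ..

lemma subspace_closure:
  assumes "subspace (G :: 'a::real_normed_vector set)"
  shows "subspace (closure G)"
  unfolding subspace_def
proof (intro conjI ballI allI)
  show "0 \<in> closure G" using subspace_0[OF assms] closure_subset by blast
  fix x assume "x \<in> closure G"
  then obtain X where X: "\<And>n. X n \<in> G" "X \<longlonglongrightarrow> x" unfolding closure_sequential by blast
  show "c *\<^sub>R x \<in> closure G" for c
    unfolding closure_sequential
    using X subspace_scale[OF assms] by (intro exI[of _ "\<lambda>n. c *\<^sub>R X n"]) (auto intro: tendsto_intros)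
  fix y assume "y \<in> closure G"
  then obtain Y where Y: "\<And>n. Y n \<in> G" "Y \<longlonglongrightarrow> y" unfolding closure_sequential by blast
  show "x + y \<in> closure G"
    unfolding closure_sequential
    using X Y subspace_add[OF assms] by (intro exI[of _ "\<lambda>n. X n + Y n"]) (auto intro: tendsto_intros)
qed

text \<open>A bounded linear relation with dense domain is contained in the graph of a bounded
  operator: its closure is still bounded, and by completeness its domain is everything.\<close>

lemma bounded_relation_extends:
  fixes G :: "('a::real_normed_vector \<times> 'b::banach) set"
  assumes G: "subspace G" and bound: "\<And>z w. (z, w) \<in> G \<Longrightarrow> norm w \<le> K * norm z"
    and dense: "closure (fst ` G) = UNIV"
  shows "\<exists>R :: 'a \<Rightarrow>\<^sub>L 'b. \<forall>(z, w)\<in>G. R z = w"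
proof -
  have bound': "norm w \<le> K * norm z" if zw: "(z, w) \<in> closure G" for z w
  proof -
    have "closed {p :: 'a \<times> 'b. norm (snd p) \<le> K * norm (fst p)}"
      by (intro closed_Collect_le continuous_intros)
    moreover have "G \<subseteq> {p. norm (snd p) \<le> K * norm (fst p)}" using bound by auto
    ultimately have "closure G \<subseteq> {p. norm (snd p) \<le> K * norm (fst p)}" by (rule closure_minimal[rotated])
    then show ?thesis using zw by auto
  qed
  have sub: "subspace (closure G)" using G by (rule subspace_closure) 
  have ex: "\<exists>w. (z, w) \<in> closure G" for z
  proof -
    obtain Z where Z: "\<And>n. Z n \<in> fst ` G" "Z \<longlonglongrightarrow> z"
      using dense closure_sequential[of z "fst ` G"] by auto
    then have "\<forall>n. \<exists>w. (Z n, w) \<in> G" by (metis fst_conv imageE prod.collapse)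
    then obtain W where W: "\<And>n. (Z n, W n) \<in> G" by metis
    have "Cauchy W"
    proof (rule CauchyI)
      fix e :: real assume "e > 0"
      define L where "L = \<bar>K\<bar> + 1"
      have L: "L > 0" "K \<le> L" by (auto simp: L_def)
      have "Cauchy Z" using Z(2) LIMSEQ_imp_Cauchy by blast
      then obtain M where M: "\<forall>m\<ge>M. \<forall>n\<ge>M. norm (Z m - Z n) < e / L"
        using CauchyD \<open>e > 0\<close> L by (metis divide_pos_pos)
      have "norm (W m - W n) < e" if "m \<ge> M" "n \<ge> M" for m n
      proof -
        have "(Z m - Z n, W m - W n) \<in> G"
          using subspace_diff[OF G W[of m] W[of n]] by simp
        then have "norm (W m - W n) \<le> K * norm (Z m - Z n)" by (rule bound)
        also have "\<dots> \<le> L * norm (Z m - Z n)" using L by (intro mult_right_mono) auto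
        also have "\<dots> < e" using M that L by (simp add: field_simps)
        finally show ?thesis .
      qed
      then show "\<exists>M. \<forall>m\<ge>M. \<forall>n\<ge>M. norm (W m - W n) < e" by blast
    qed
    then obtain w where "W \<longlonglongrightarrow> w" using Cauchy_convergent convergent_def by blast
    then have "(\<lambda>n. (Z n, W n)) \<longlonglongrightarrow> (z, w)" using Z(2) by (intro tendsto_Pair)
    then have "(z, w) \<in> closure G"
      unfolding closure_sequential using W by (intro exI[of _ "\<lambda>n. (Z n, W n)"]) blast
    then show ?thesis by blast
  qed
  have uniq: "w = w'" if "(z, w) \<in> closure G" "(z, w') \<in> closure G" for z w w'
    using bound'[of 0 "w - w'"] subspace_diff[OF sub that] by simp
  define R where "R z = (SOME w. (z, w) \<in> closure G)" for z
  have R: "(z, R z) \<in> closure G" for z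
    unfolding R_def using ex by (rule someI_ex)
  have "bounded_linear R"
  proof (rule bounded_linear_intro)
    fix x y and r :: real
    show "R (x + y) = R x + R y"
      using uniq[OF R] subspace_add[OF sub R[of x] R[of y]] by simp
    show "R (r *\<^sub>R x) = r *\<^sub>R R x"
      using uniq[OF R] subspace_scale[OF sub R[of x], of r] by simp
    show "norm (R x) \<le> norm x * K"
      using bound'[OF R] by (simp add: mult.commute)
  qed
  moreover have "R z = w" if "(z, w) \<in> G" for z w
    using uniq[OF R] that closure_subset[of G] by blast
  ultimately show ?thesis
    by (intro exI[of _ "Blinfun R"]) (auto simp: bounded_linear_Blinfun_apply)
qed

text \<open>The two factors play symmetric roles. Estimates are proved for operators on the second factor
  and transferred to the first one by \<open>swap\<close>.\<close>

locale tensor =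
  fixes t :: "'a::chilbert_space \<Rightarrow> 'b::chilbert_space \<Rightarrow> 'k::chilbert_space"
  assumes hilbert_tensor: "hilbert_tensor t"
begin

lemma t_add_left: "t (x + x') y = t x y + t x' y"
  and t_add_right: "t x (y + y') = t x y + t x y'"
  and t_scaleC_left: "t (c *\<^sub>C x) y = c *\<^sub>C t x y"
  and t_scaleC_right: "t x (c *\<^sub>C y) = c *\<^sub>C t x y"
  and cinner_t: "cinner (t x y) (t x' y') = cinner x x' * cinner y y'"
  and dense_cspan: "closure (cspan {t x y | x y. True}) = UNIV"
  using hilbert_tensor unfolding hilbert_tensor_def by blast+

lemma swap: "tensor (\<lambda>y x. t x y)"
proof
  have "{t x y | y x. True} = {t x y | x y. True}" by blast
  then show "Defs.hilbert_tensor (\<lambda>y x. t x y)"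
    using dense_cspan
    by (simp add: hilbert_tensor_def t_add_left t_add_right t_scaleC_left t_scaleC_right cinner_t
        mult.commute)
qed

lemma t_scaleR_left: "t (r *\<^sub>R x) y = r *\<^sub>R t x y"
  by (simp add: scaleR_scaleC t_scaleC_left)

lemma t_zero_left: "t 0 y = 0"
  using t_scaleC_left[of 0 0 y] by simp

lemma t_zero_right: "t x 0 = 0"
  using t_scaleC_right[of x 0 0] by simp

lemma t_sum_left: "t (\<Sum>j\<in>J. f j) y = (\<Sum>j\<in>J. t (f j) y)"
proof -
  interpret Modules.additive "\<lambda>x. t x y" by standard (rule t_add_left)
  show ?thesis by (rule sum)
qed

lemma t_sum_right: "t x (\<Sum>j\<in>J. f j) = (\<Sum>j\<in>J. t x (f j))"
  by (rule tensor.t_sum_left[OF swap])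

lemma norm_t: "norm (t x y) = norm x * norm y"
proof -
  have "complex_of_real ((norm (t x y))\<^sup>2) = complex_of_real ((norm x * norm y)\<^sup>2)"
    unfolding cinner_self[symmetric] cinner_t by (simp add: cinner_self power_mult_distrib)
  then have "(norm (t x y))\<^sup>2 = (norm x * norm y)\<^sup>2" by (simp only: of_real_eq_iff)
  then show ?thesis by (simp add: power2_eq_iff_nonneg)
qed

lemma dense: "closure (span {t x y | x y. True}) = UNIV"
proof -
  let ?S = "{t x y | x y. True}"
  have scale: "c *\<^sub>C a \<in> ?S" if "a \<in> ?S" for a c
    using that t_scaleC_left[symmetric] by blast
  have "cspan ?S \<subseteq> span ?S"
  proof
    fix z assume "z \<in> cspan ?S"
    then obtain D r where D: "finite D" "D \<subseteq> ?S" "z = (\<Sum>a\<in>D. r a *\<^sub>C a)"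
      unfolding complex_vector.span_explicit by blast
    have "r a *\<^sub>C a \<in> ?S" if "a \<in> D" for a using D(2) that scale by blast
    then show "z \<in> span ?S" unfolding D(3) by (intro span_sum span_base)
  qed
  then show ?thesis using closure_mono[of "cspan ?S" "span ?S"] dense_cspan by auto
qed

lemma dense_subspace_UNIV:
  assumes "closed S" "subspace S" "\<And>x y. t x y \<in> S"
  shows "z \<in> S"
proof -
  have "span {t x y | x y. True} \<subseteq> S" using assms by (intro span_minimal) auto
  then have "closure (span {t x y | x y. True}) \<subseteq> S" using assms(1) by (rule closure_minimal)
  then show ?thesis unfolding dense by blast
qed

lemma eq_on_elementary_tensors:
  assumes "bounded_linear f" "bounded_linear g" "\<And>x y. f (t x y) = g (t x y)"
  shows "f z = g z"
proof -
  have "z \<in> {z. f z = g z}"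
  proof (rule dense_subspace_UNIV)
    show "closed {z. f z = g z}"
      using assms(1,2) by (intro closed_Collect_eq linear_continuous_on)
    show "subspace {z. f z = g z}"
      using assms(1,2) by (auto simp: subspace_def bounded_linear.linear linear_0 linear_add linear_scale)
  qed (use assms(3) in auto)
  then show ?thesis by simp
qed

text \<open>Once the first factors \<open>x j\<close> are expanded in a finite orthonormal system, the norm of a finite
  sum of elementary tensors is the square sum of the norms of its coefficients in the second
  factor. So an estimate for operators on the second factor carries over to the tensor product.\<close>

lemma column_estimate_elementary:
  fixes B :: "'n \<Rightarrow> 'b \<Rightarrow>\<^sub>L 'b" and x :: "'j \<Rightarrow> 'a"
  assumes J: "finite J" and B: "\<And>i. i \<in> I \<Longrightarrow> B i \<in> bounded_ops"
    and le: "\<And>y. (\<Sum>i\<in>I. (norm (B i y))\<^sup>2) \<le> c * (norm y)\<^sup>2"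
  shows "(\<Sum>i\<in>I. (norm (\<Sum>j\<in>J. t (x j) (B i (y j))))\<^sup>2) \<le> c * (norm (\<Sum>j\<in>J. t (x j) (y j)))\<^sup>2"
proof -
  obtain D where D: "finite D" "orthonormal_on D (\<lambda>b. b)"
    "\<And>j. j \<in> J \<Longrightarrow> x j = (\<Sum>b\<in>D. cinner (x j) b *\<^sub>C b)"
    using Gram_Schmidt[of "x ` J"] J by blast
  have nD: "norm b = 1" if "b \<in> D" for b
  using D(2) that by (intro norm_eq_1_cinner) (simp add: orthonormal_on_def)
  have expand: "(norm (\<Sum>j\<in>J. t (x j) (v j)))\<^sup>2 = (\<Sum>b\<in>D. (norm (\<Sum>j\<in>J. cinner (x j) b *\<^sub>C v j))\<^sup>2)"
    for v
  proof -
    have "(\<Sum>j\<in>J. t (x j) (v j)) = (\<Sum>j\<in>J. t (\<Sum>b\<in>D. cinner (x j) b *\<^sub>C b) (v j))"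
      using D(3) by (intro sum.cong) auto
    also have "\<dots> = (\<Sum>b\<in>D. t b (\<Sum>j\<in>J. cinner (x j) b *\<^sub>C v j))"
      unfolding t_sum_left t_sum_right t_scaleC_left t_scaleC_right by (rule sum.swap)
    also have "(norm \<dots>)\<^sup>2 = (\<Sum>b\<in>D. (norm (t b (\<Sum>j\<in>J. cinner (x j) b *\<^sub>C v j)))\<^sup>2)"
      using D by (intro norm_sum_orthogonal) (auto simp: cinner_t orthonormal_on_def)
    finally show ?thesis using nD by (simp add: norm_t)
  qed
  have "(\<Sum>i\<in>I. (norm (\<Sum>j\<in>J. t (x j) (B i (y j))))\<^sup>2)
      = (\<Sum>i\<in>I. \<Sum>b\<in>D. (norm (B i (\<Sum>j\<in>J. cinner (x j) b *\<^sub>C y j)))\<^sup>2)"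
    unfolding expand using B by (intro sum.cong refl) (simp add: blinfun.sum_right bounded_opsD)
  also have "\<dots> = (\<Sum>b\<in>D. \<Sum>i\<in>I. (norm (B i (\<Sum>j\<in>J. cinner (x j) b *\<^sub>C y j)))\<^sup>2)"
    by (rule sum.swap)
  also have "\<dots> \<le> (\<Sum>b\<in>D. c * (norm (\<Sum>j\<in>J. cinner (x j) b *\<^sub>C y j))\<^sup>2)"
    by (intro sum_mono le)
  also have "\<dots> = c * (norm (\<Sum>j\<in>J. t (x j) (y j)))\<^sup>2"
    unfolding expand by (simp add: sum_distrib_left)
  finally show ?thesis .
qed

lemma norm_elementary_le_right:
  assumes "finite J" "B \<in> bounded_ops"
  shows "norm (\<Sum>j\<in>J. t (x j) (blinfun_apply B (y j))) \<le> norm B * norm (\<Sum>j\<in>J. t (x j) (y j))"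
proof -
  have "(norm (B v))\<^sup>2 \<le> (norm B)\<^sup>2 * (norm v)\<^sup>2" for v
    using power_mono[OF norm_blinfun[of B v], of 2] by (simp add: power_mult_distrib)
  then have "(norm (\<Sum>j\<in>J. t (x j) (B (y j))))\<^sup>2 \<le> (norm B * norm (\<Sum>j\<in>J. t (x j) (y j)))\<^sup>2"
    using column_estimate_elementary[of J "{()}" "\<lambda>_. B" "(norm B)\<^sup>2" x y] assms
    by (simp add: power_mult_distrib)
  then show ?thesis by (simp add: power2_le_iff_abs_le)
qed

lemma norm_elementary_le:
  assumes "finite J" "T \<in> bounded_ops" "B \<in> bounded_ops"
  shows "norm (\<Sum>j\<in>J. t (blinfun_apply T (x j)) (blinfun_apply B (y j)))
    \<le> norm T * norm B * norm (\<Sum>j\<in>J. t (x j) (y j))"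
proof -
  have "norm (\<Sum>j\<in>J. t (T (x j)) (B (y j))) \<le> norm T * norm (\<Sum>j\<in>J. t (x j) (B (y j)))"
    using tensor.norm_elementary_le_right[OF swap assms(1,2)] .
  also have "\<dots> \<le> norm T * (norm B * norm (\<Sum>j\<in>J. t (x j) (y j)))"
    using assms by (intro mult_left_mono norm_elementary_le_right) auto
  finally show ?thesis by (simp add: mult.assoc)
qed

text \<open>Different sums of elementary tensors may represent the same vector, so the prescribed values are
  first collected in a relation; the norm estimate shows that it is single valued and bounded.\<close>

lemma tensor_op_exists:
  fixes T :: "'a \<Rightarrow>\<^sub>L 'a" and B :: "'b \<Rightarrow>\<^sub>L 'b"
  assumes T: "T \<in> bounded_ops" and B: "B \<in> bounded_ops"
  shows "\<exists>R. R \<in> bounded_ops \<and> (\<forall>x y. blinfun_apply R (t x y) = t (T x) (B y))"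
proof -
  define S where "S = {(t x y, t (T x) (B y)) | x y. True}"
  have "\<exists>R :: 'k \<Rightarrow>\<^sub>L 'k. \<forall>(z, w)\<in>span S. R z = w"
  proof (rule bounded_relation_extends)
    show "subspace (span S)" by (rule subspace_span)
    have "fst ` span S = span (fst ` S)"
      by (rule linear_span_image[symmetric]) (simp add: linear_iff)
    also have "fst ` S = {t x y | x y. True}" unfolding S_def by force
    finally show "closure (fst ` span S) = UNIV" by (simp only: dense)
    fix z w assume "(z, w) \<in> span S"
    then obtain D r where D: "finite D" "D \<subseteq> S" "(z, w) = (\<Sum>a\<in>D. r a *\<^sub>R a)"
      unfolding span_explicit by blast
    have "\<forall>a\<in>D. \<exists>x y. a = (t x y, t (T x) (B y))" using D(2) by (auto simp: S_def)
    then obtain x y where xy: "\<And>a. a \<in> D \<Longrightarrow> a = (t (x a) (y a), t (T (x a)) (B (y a)))"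
      by metis
    have "r a *\<^sub>R a = (t (r a *\<^sub>R x a) (y a), t (T (r a *\<^sub>R x a)) (B (y a)))" if "a \<in> D" for a
      using xy[OF that]
      by (metis scaleR_Pair t_scaleR_left blinfun.scaleR_right)
    then have "(z, w) = (\<Sum>a\<in>D. (t (r a *\<^sub>R x a) (y a), t (T (r a *\<^sub>R x a)) (B (y a))))"
      using D(3) by simp
    then have "z = (\<Sum>a\<in>D. t (r a *\<^sub>R x a) (y a))" "w = (\<Sum>a\<in>D. t (T (r a *\<^sub>R x a)) (B (y a)))"
      by (simp_all add: sum_prod)
    then show "norm w \<le> norm T * norm B * norm z"
      using norm_elementary_le[OF D(1) T B, of "\<lambda>a. r a *\<^sub>R x a" y] by simp
  qed
  then obtain R :: "'k \<Rightarrow>\<^sub>L 'k" where R0: "\<forall>(z, w)\<in>span S. R z = w" by blast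
  have S: "(t x y, t (T x) (B y)) \<in> span S" for x y
    unfolding S_def by (intro span_base) blast
  have R: "R (t x y) = t (T x) (B y)" for x y using bspec[OF R0 S[of x y]] by simp
  have "R (c *\<^sub>C z) = c *\<^sub>C R z" for c z
    by (rule eq_on_elementary_tensors)
      (auto intro!: bounded_linear_compose[OF blinfun.bounded_linear_right]
        bounded_linear_compose[OF bounded_linear_scaleC] bounded_linear_scaleC
        blinfun.bounded_linear_right
        simp: R bounded_opsD[OF T] simp flip: t_scaleC_left)
  then show ?thesis using R by (auto simp: bounded_ops_def)
qed

lemma tensor_op_eqI:
  assumes "R \<in> bounded_ops" "\<And>x y. blinfun_apply R (t x y) = t (blinfun_apply T x) (blinfun_apply B y)"
  shows "tensor_op t T B = R"
  unfolding tensor_op_def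
proof (rule the_equality)
  fix R' :: "'k \<Rightarrow>\<^sub>L 'k"
  assume R': "R' \<in> bounded_ops \<and> (\<forall>x y. blinfun_apply R' (t x y) = t (blinfun_apply T x) (blinfun_apply B y))"
  show "R' = R"
    by (rule blinfun_eqI, rule eq_on_elementary_tensors)
      (use R' assms in \<open>auto intro: blinfun.bounded_linear_right\<close>)
qed (use assms in auto)

lemma
  assumes "T \<in> bounded_ops" "B \<in> bounded_ops"
  shows tensor_op_bounded_ops: "tensor_op t T B \<in> bounded_ops"
    and tensor_op_apply: "tensor_op t T B (t x y) = t (blinfun_apply T x) (blinfun_apply B y)"
proof -
  obtain R where R: "R \<in> bounded_ops"
    "\<And>x y. blinfun_apply R (t x y) = t (blinfun_apply T x) (blinfun_apply B y)"
    using tensor_op_exists[OF assms] by blast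
  have "tensor_op t T B = R" by (rule tensor_op_eqI) (use R in auto)
  then show "tensor_op t T B \<in> bounded_ops"
    "tensor_op t T B (t x y) = t (blinfun_apply T x) (blinfun_apply B y)" using R by auto
qed

lemma tensor_op_swap: "tensor_op (\<lambda>y x. t x y) B T = tensor_op t T B"
  unfolding tensor_op_def by (rule arg_cong[where f = The]) (auto simp: fun_eq_iff)

lemma column_estimate:
  fixes B :: "'n \<Rightarrow> 'b \<Rightarrow>\<^sub>L 'b"
  assumes B: "\<And>i. i \<in> I \<Longrightarrow> B i \<in> bounded_ops"
    and le: "\<And>y. (\<Sum>i\<in>I. (norm (B i y))\<^sup>2) \<le> c * (norm y)\<^sup>2"
  shows "(\<Sum>i\<in>I. (norm (tensor_op t id_blinfun (B i) z))\<^sup>2) \<le> c * (norm z)\<^sup>2"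
proof -
  let ?P = "\<lambda>z. (\<Sum>i\<in>I. (norm (tensor_op t id_blinfun (B i) z))\<^sup>2) \<le> c * (norm z)\<^sup>2"
  have "span {t x y | x y. True} \<subseteq> {z. ?P z}"
  proof
    fix z assume "z \<in> span {t x y | x y. True}"
    then obtain D r where D: "finite D" "D \<subseteq> {t x y | x y. True}" "z = (\<Sum>a\<in>D. r a *\<^sub>R a)"
      unfolding span_explicit by blast
    have "\<forall>a\<in>D. \<exists>x y. a = t x y" using D(2) by auto
    then obtain x y where xy: "\<And>a. a \<in> D \<Longrightarrow> a = t (x a) (y a)" by metis
    then have z: "z = (\<Sum>a\<in>D. t (r a *\<^sub>R x a) (y a))"
      unfolding D(3) by (intro sum.cong) (auto simp: t_scaleR_left)
    have "(\<Sum>i\<in>I. (norm (tensor_op t id_blinfun (B i) z))\<^sup>2)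
      = (\<Sum>i\<in>I. (norm (\<Sum>a\<in>D. t (r a *\<^sub>R x a) (B i (y a))))\<^sup>2)"
      using B by (intro sum.cong) (auto simp: z blinfun.sum_right tensor_op_apply bounded_ops_id)
    also have "\<dots> \<le> c * (norm z)\<^sup>2"
      unfolding z by (rule column_estimate_elementary[OF D(1) B le])
    finally show "z \<in> {z. ?P z}" by simp
  qed
  moreover have "closed {z. ?P z}"
    by (intro closed_Collect_le continuous_intros)
  ultimately have "closure (span {t x y | x y. True}) \<subseteq> {z. ?P z}" by (rule closure_minimal)
  then show ?thesis unfolding dense by blast
qed

lemma cadjoint_tensor_op:
  assumes "T \<in> bounded_ops" "B \<in> bounded_ops"
  shows "cadjoint (tensor_op t T B) = tensor_op t (cadjoint T) (cadjoint B)"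
proof (rule cadjoint_eqI)
  show "tensor_op t (cadjoint T) (cadjoint B) \<in> bounded_ops"
    using assms by (simp add: tensor_op_bounded_ops cadjoint_bounded_ops)
  fix z w
  have "cinner (tensor_op t T B z) (t x y) = cinner z (tensor_op t (cadjoint T) (cadjoint B) (t x y))"
    for x y
    by (rule eq_on_elementary_tensors)
      (auto intro!: bounded_linear_compose[OF bounded_linear_cinner_left] bounded_linear_cinner_left
        blinfun.bounded_linear_right
        simp: tensor_op_apply assms cadjoint_bounded_ops cinner_t cinner_cadjoint)
  then have "cnj (cinner (tensor_op t T B z) (t x y))
      = cnj (cinner z (tensor_op t (cadjoint T) (cadjoint B) (t x y)))" for x y by simp
  then have *: "cinner (t x y) (tensor_op t T B z)
      = cinner (tensor_op t (cadjoint T) (cadjoint B) (t x y)) z" for x y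
    by (metis cinner_commute)
  have "cinner w (tensor_op t T B z) = cinner (tensor_op t (cadjoint T) (cadjoint B) w) z"
    by (rule eq_on_elementary_tensors)
      (auto intro!: bounded_linear_compose[OF bounded_linear_cinner_left] bounded_linear_cinner_left
        blinfun.bounded_linear_right simp: *)
  then show "cinner (tensor_op t T B z) w = cinner z (tensor_op t (cadjoint T) (cadjoint B) w)"
    by (metis cinner_commute)
qed

lemma tensor_op_factor:
  assumes "T \<in> bounded_ops" "B \<in> bounded_ops"
  shows "tensor_op t T B = tensor_op t T id_blinfun o\<^sub>L tensor_op t id_blinfun B"
  by (rule tensor_op_eqI)
    (simp_all add: assms tensor_op_bounded_ops bounded_ops_compose bounded_ops_id tensor_op_apply)

lemma cinner_tensor_op:
  assumes "T \<in> bounded_ops" "B \<in> bounded_ops"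
  shows "cinner (tensor_op t T B z) w
    = cinner (tensor_op t id_blinfun B z) (tensor_op t (cadjoint T) id_blinfun w)"
  using assms
  by (simp add: tensor_op_factor[OF assms] cinner_cadjoint tensor_op_bounded_ops bounded_ops_id
      cadjoint_tensor_op cadjoint_id)

text \<open>The sum is a row operator after a column operator, \<open>[T\<^sub>i \<otimes> I]\<^sub>i [I \<otimes> B\<^sub>i]\<^sub>i\<close>; the adjoint of the
  row is the column of the \<open>T\<^sub>i\<^sup>* \<otimes> I\<close>, so both factors are controlled by column estimates.\<close>

lemma row_column_estimate:
  fixes T :: "'n \<Rightarrow> 'a \<Rightarrow>\<^sub>L 'a" and B :: "'n \<Rightarrow> 'b \<Rightarrow>\<^sub>L 'b"
  assumes T: "\<And>i. i \<in> I \<Longrightarrow> T i \<in> bounded_ops" and B: "\<And>i. i \<in> I \<Longrightarrow> B i \<in> bounded_ops"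
    and le: "\<And>x. (\<Sum>i\<in>I. (norm (cadjoint (T i) x))\<^sup>2) \<le> c\<^sup>2 * (norm x)\<^sup>2" and "c \<ge> 0"
  shows "norm (\<Sum>i\<in>I. tensor_op t (T i) (B i) z)
    \<le> c * sqrt (\<Sum>i\<in>I. (norm (tensor_op t id_blinfun (B i) z))\<^sup>2)"
proof -
  define w where "w = (\<Sum>i\<in>I. tensor_op t (T i) (B i) z)"
  let ?b = "\<lambda>i. tensor_op t id_blinfun (B i) z"
  let ?a = "\<lambda>i. tensor_op t (cadjoint (T i)) id_blinfun w"
  have "(\<Sum>i\<in>I. (norm (?a i))\<^sup>2) \<le> c\<^sup>2 * (norm w)\<^sup>2"
    using tensor.column_estimate[OF swap, of I "\<lambda>i. cadjoint (T i)" "c\<^sup>2" w] le T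
    by (simp add: tensor_op_swap cadjoint_bounded_ops)
  then have a: "L2_set (\<lambda>i. norm (?a i)) I \<le> c * norm w"
    using \<open>c \<ge> 0\<close> unfolding L2_set_def by (intro real_le_lsqrt) (auto simp: power_mult_distrib)
  have "(norm w)\<^sup>2 = cmod (cinner w w)" by (simp add: cinner_self norm_power)
  also have "cinner w w = (\<Sum>i\<in>I. cinner (?b i) (?a i))"
    by (subst w_def) (simp add: cinner_sum_left cinner_tensor_op T B)
  also have "cmod \<dots> \<le> (\<Sum>i\<in>I. norm (?b i) * norm (?a i))"
    by (rule sum_norm_le) (rule norm_cinner_le)
  also have "\<dots> \<le> L2_set (\<lambda>i. norm (?b i)) I * L2_set (\<lambda>i. norm (?a i)) I"
    using L2_set_mult_ineq[of "\<lambda>i. norm (?b i)" "\<lambda>i. norm (?a i)" I] by simp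
  also have "\<dots> \<le> L2_set (\<lambda>i. norm (?b i)) I * (c * norm w)"
    using a by (intro mult_left_mono) auto
  finally have "norm w * norm w \<le> (c * L2_set (\<lambda>i. norm (?b i)) I) * norm w"
    by (simp add: power2_eq_square mult_ac)
  then have "norm w \<le> c * L2_set (\<lambda>i. norm (?b i)) I"
    using \<open>c \<ge> 0\<close> by (cases "norm w = 0") (auto simp: mult_le_cancel_right)
  then show ?thesis by (simp add: w_def L2_set_def)
qed

end


section \<open>Strongly convergent series of operators\<close>

text \<open>Unlike in the comparison test, the dominating series is one of squares: this is the form of
  convergence of orthogonal series, which need not converge absolutely.\<close>

lemma summable_on_dominated:
  fixes f :: "'j \<Rightarrow> 'a::banach" and a :: "'j \<Rightarrow> real"
  assumes a: "a summable_on W" and nonneg: "\<And>w. w \<in> W \<Longrightarrow> 0 \<le> a w"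
    and dom: "\<And>J. finite J \<Longrightarrow> J \<subseteq> W \<Longrightarrow> norm (\<Sum>w\<in>J. f w) \<le> c * sqrt (\<Sum>w\<in>J. a w)"
    and c: "c \<ge> 0"
  shows "f summable_on W"
proof -
  let ?F = "finite_subsets_at_top W"
  have "cauchy_filter (filtermap (sum f) ?F)"
    unfolding cauchy_filter_metric_filtermap
  proof (intro allI impI)
    fix e :: real assume "e > 0"
    define d where "d = (e / (2 * (c + 1)))\<^sup>2"
    have "d > 0" using \<open>e > 0\<close> c by (simp add: d_def)
    have "(sum a \<longlongrightarrow> infsum a W) ?F" using has_sum_infsum[OF a] by (simp add: has_sum_def)
    then have "eventually (\<lambda>J. dist (sum a J) (infsum a W) < d) ?F"
      using \<open>d > 0\<close> by (rule tendstoD)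
    then have "\<exists>J0. finite J0 \<and> J0 \<subseteq> W \<and>
        (\<forall>J. finite J \<and> J0 \<subseteq> J \<and> J \<subseteq> W \<longrightarrow> dist (sum a J) (infsum a W) < d)"
      by (simp only: eventually_finite_subsets_at_top)
    then obtain J0 where J0: "finite J0" "J0 \<subseteq> W"
      "\<And>J. finite J \<Longrightarrow> J0 \<subseteq> J \<Longrightarrow> J \<subseteq> W \<Longrightarrow> dist (sum a J) (infsum a W) < d"
      by (elim exE conjE) simp
    let ?P = "\<lambda>J. finite J \<and> J0 \<subseteq> J \<and> J \<subseteq> W"
    have near: "dist (sum f J) (sum f J0) < e / 2" if "?P J" for J
    proof -
      have "sum f J = sum f (J - J0) + sum f J0" "sum a J = sum a (J - J0) + sum a J0"
        using that sum.subset_diff[of J0 J f] sum.subset_diff[of J0 J a] by simp_all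
      moreover have "sum a J \<le> infsum a W"
        using that a nonneg by (intro finite_sum_le_infsum) auto
      ultimately have "sum a (J - J0) < d" "dist (sum f J) (sum f J0) = norm (sum f (J - J0))"
        using J0(3)[of J0] J0(1,2) by (auto simp: dist_norm dist_real_def)
      moreover have "norm (sum f (J - J0)) \<le> c * sqrt (sum a (J - J0))"
        using that by (intro dom) auto
      moreover have "c * sqrt (sum a (J - J0)) \<le> c * sqrt d"
        using \<open>sum a (J - J0) < d\<close> c by (intro mult_left_mono) auto
      moreover have "c * sqrt d < e / 2"
      proof -
        have "sqrt d = e / (2 * (c + 1))" unfolding d_def real_sqrt_abs using \<open>e > 0\<close> c by simp
        also have "c * (e / (2 * (c + 1))) < e / 2" using \<open>e > 0\<close> c by (simp add: field_simps)
        finally show ?thesis .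
      qed
      ultimately show ?thesis by linarith
    qed
    have "eventually ?P ?F"
      unfolding eventually_finite_subsets_at_top using J0 by blast
    moreover have "dist (sum f J) (sum f J') < e" if "?P J \<and> ?P J'" for J J'
      using near[of J] near[of J'] that dist_triangle2[of "sum f J" "sum f J'" "sum f J0"] by linarith
    ultimately show "\<exists>P. eventually P ?F \<and> (\<forall>J J'. P J \<and> P J' \<longrightarrow> dist (sum f J) (sum f J') < e)"
      by blast
  qed
  moreover have "complete (UNIV :: 'a set)"
    by (meson Cauchy_convergent UNIV_I complete_def convergent_def)
  ultimately obtain L where "(sum f \<longlongrightarrow> L) ?F"
    using complete_uniform[where S = UNIV] by (force simp add: filterlim_def)
  then show ?thesis using summable_on_def has_sum_def by blast
qed

lemma has_sum_norm_le:
  fixes f :: "'j \<Rightarrow> 'a::real_normed_vector"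
  assumes "(f has_sum x) W" "\<And>J. finite J \<Longrightarrow> J \<subseteq> W \<Longrightarrow> norm (\<Sum>w\<in>J. f w) \<le> c"
  shows "norm x \<le> c"
proof (rule tendsto_upperbound)
  show "((\<lambda>J. norm (sum f J)) \<longlongrightarrow> norm x) (finite_subsets_at_top W)"
    using assms(1) unfolding has_sum_def by (rule tendsto_norm)
  show "\<forall>\<^sub>F J in finite_subsets_at_top W. norm (sum f J) \<le> c"
    using assms(2) by (intro eventually_finite_subsets_at_top_weakI) auto
qed simp

lemma has_strong_sumD:
  "has_strong_sum f T J \<Longrightarrow> ((\<lambda>j. blinfun_apply (f j) x) has_sum blinfun_apply T x) J"
  by (simp add: has_strong_sum_def)

lemma strong_sum_eqI: "has_strong_sum f T J \<Longrightarrow> strong_sum f J = T"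
  unfolding strong_sum_def
  by (rule the_equality) (auto intro!: blinfun_eqI has_sum_unique dest: has_strong_sumD)

lemma has_strong_sum_strong_sum: "strongly_summable f J \<Longrightarrow> has_strong_sum f (strong_sum f J) J"
  unfolding strongly_summable_def using strong_sum_eqI by metis

lemma has_strong_sum_bounded_ops:
  assumes "has_strong_sum f T J" "\<And>j. j \<in> J \<Longrightarrow> f j \<in> bounded_ops"
  shows "T \<in> bounded_ops"
proof -
  have "T (c *\<^sub>C x) = c *\<^sub>C T x" for c x
  proof (rule has_sum_unique)
    show "((\<lambda>j. f j (c *\<^sub>C x)) has_sum T (c *\<^sub>C x)) J" using assms(1) by (rule has_strong_sumD)
    have "((\<lambda>j. c *\<^sub>C f j x) has_sum c *\<^sub>C T x) J"
      by (intro has_sum_bounded_linear[OF bounded_linear_scaleC] has_strong_sumD assms)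
    then show "((\<lambda>j. f j (c *\<^sub>C x)) has_sum c *\<^sub>C T x) J"
      using assms(2) by (simp add: bounded_opsD cong: has_sum_cong)
  qed
  then show ?thesis by (simp add: bounded_ops_def)
qed

lemma op_tuplesD: "X \<in> op_tuples \<Longrightarrow> X i \<in> bounded_ops"
  by (simp add: op_tuples_def)

text \<open>The quadratic form of the sum of the \<open>X\<^sub>i X\<^sub>i\<^sup>*\<close>, whose norm is the square of the row norm, is the
  sum of the squared norms of the \<open>X\<^sub>i\<^sup>* x\<close>: the row \<open>X\<close> is controlled by the column of adjoints.\<close>

lemma op_tuple_column_le:
  assumes X: "X \<in> op_tuples" and I: "finite I"
  shows "(\<Sum>i\<in>I. (norm (cadjoint (X i) x))\<^sup>2) \<le> (row_norm X)\<^sup>2 * (norm x)\<^sup>2"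
proof -
  define T where "T = strong_sum (\<lambda>i. X i o\<^sub>L cadjoint (X i)) UNIV"
  have T: "has_strong_sum (\<lambda>i. X i o\<^sub>L cadjoint (X i)) T UNIV"
    using X unfolding T_def op_tuples_def by (intro has_strong_sum_strong_sum) auto
  have "((\<lambda>i. inner ((X i o\<^sub>L cadjoint (X i)) x) x) has_sum inner (T x) x) UNIV"
    by (intro has_sum_bounded_linear[OF bounded_linear_inner_left] has_strong_sumD[OF T])
  moreover have "inner ((X i o\<^sub>L cadjoint (X i)) x) x = (norm (cadjoint (X i) x))\<^sup>2" for i
    using op_tuplesD[OF X, of i]
    by (simp add: inner_eq_Re_cinner cinner_cadjoint power2_norm_eq_inner)
  ultimately have "((\<lambda>i. (norm (cadjoint (X i) x))\<^sup>2) has_sum inner (T x) x) UNIV" by simp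
  then have "(\<Sum>i\<in>I. (norm (cadjoint (X i) x))\<^sup>2) \<le> inner (T x) x"
    by (rule has_sum_mono_neutral[OF has_sum_finite[OF I]]) auto
  also have "\<dots> \<le> norm (T x) * norm x" by (rule norm_cauchy_schwarz)
  also have "\<dots> \<le> norm T * norm x * norm x" by (intro mult_right_mono norm_blinfun) auto
  finally show ?thesis by (simp add: row_norm_def T_def power2_eq_square)
qed

lemma word_op_bounded_ops: "(\<And>i. X i \<in> bounded_ops) \<Longrightarrow> word_op X w \<in> bounded_ops"
  by (induction w) (auto simp: bounded_ops_id bounded_ops_compose)

text \<open>As \<open>X\<^sub>i\<^sub>v\<^sup>* = X\<^sub>v\<^sup>* X\<^sub>i\<^sup>*\<close>, columns for words of length \<open>k + 1\<close> are columns for words of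
  length \<open>k\<close> stacked over the column of the \<open>X\<^sub>i\<^sup>*\<close>. A finite set of words is enlarged to a
  product of first letters and remainders, to make the sum iterated.\<close>

lemma word_column_le:
  assumes X: "X \<in> op_tuples"
  shows "finite J \<Longrightarrow> J \<subseteq> {w. length w = k} \<Longrightarrow>
    (\<Sum>w\<in>J. (norm (cadjoint (word_op X w) x))\<^sup>2) \<le> (row_norm X ^ k)\<^sup>2 * (norm x)\<^sup>2"
proof (induction k arbitrary: J x)
  case 0
  then have "J \<subseteq> {[]}" by auto
  then have "J = {} \<or> J = {[]}" by auto
  then show ?case by (auto simp: cadjoint_id)
next
  case (Suc k)
  let ?n = "\<lambda>w. (norm (cadjoint (word_op X w) x))\<^sup>2"
  have split: "?n (i # v) = (norm (cadjoint (word_op X v) (cadjoint (X i) x)))\<^sup>2" for i v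
    using op_tuplesD[OF X] by (simp add: cadjoint_compose word_op_bounded_ops)
  have "(\<Sum>w\<in>J. ?n w) \<le> (\<Sum>w\<in>(\<lambda>(i, v). i # v) ` (hd ` J \<times> tl ` J). ?n w)"
  proof (rule sum_mono2)
    show "J \<subseteq> (\<lambda>(i, v). i # v) ` (hd ` J \<times> tl ` J)"
    proof
      fix w assume "w \<in> J"
      moreover from this have "w = hd w # tl w" using Suc.prems by (cases w) auto
      ultimately show "w \<in> (\<lambda>(i, v). i # v) ` (hd ` J \<times> tl ` J)"
        by (intro image_eqI[of _ _ "(hd w, tl w)"]) auto
    qed
  qed (use Suc.prems in auto)
  also have "\<dots> = (\<Sum>(i, v)\<in>hd ` J \<times> tl ` J. ?n (i # v))"
    by (subst sum.reindex) (auto simp: inj_on_def o_def case_prod_unfold)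
  also have "\<dots> = (\<Sum>i\<in>hd ` J. \<Sum>v\<in>tl ` J. (norm (cadjoint (word_op X v) (cadjoint (X i) x)))\<^sup>2)"
    unfolding split by (rule sum.cartesian_product[symmetric])
  also have "\<dots> \<le> (\<Sum>i\<in>hd ` J. (row_norm X ^ k)\<^sup>2 * (norm (cadjoint (X i) x))\<^sup>2)"
    using Suc.prems by (intro sum_mono Suc.IH) auto
  also have "\<dots> = (row_norm X ^ k)\<^sup>2 * (\<Sum>i\<in>hd ` J. (norm (cadjoint (X i) x))\<^sup>2)"
    by (simp add: sum_distrib_left)
  also have "\<dots> \<le> (row_norm X ^ k)\<^sup>2 * ((row_norm X)\<^sup>2 * (norm x)\<^sup>2)"
    using Suc.prems by (intro mult_left_mono op_tuple_column_le X) auto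
  also have "\<dots> = (row_norm X ^ Suc k)\<^sup>2 * (norm x)\<^sup>2"
    by (simp add: power2_eq_square mult_ac)
  finally show ?case .
qed

lemma row_norm_nonneg: "row_norm X \<ge> 0"
  by (simp add: row_norm_def)

text \<open>By the row-column estimate, a partial sum at \<open>z\<close> is dominated by the corresponding partial sum
  of the series of the squared norms of the \<open>(I \<otimes> A w) z\<close>, which converges by the column estimate.
  This gives the strong convergence as well as the bound.\<close>

lemma (in tensor) homogeneous_part_estimate:
  fixes A :: "'i::countable list \<Rightarrow> 'b \<Rightarrow>\<^sub>L 'b" and X :: "'i \<Rightarrow> 'a \<Rightarrow>\<^sub>L 'a"
  assumes X: "X \<in> op_tuples" and A: "\<And>w. A w \<in> bounded_ops" and M: "M \<ge> 0"
    and col: "\<And>J y. finite J \<Longrightarrow> J \<subseteq> {w. length w = k} \<Longrightarrow>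
      (\<Sum>w\<in>J. (norm (A w y))\<^sup>2) \<le> M\<^sup>2 * (norm y)\<^sup>2"
  shows "strongly_summable (homogeneous_term t A X) {w. length w = k}"
    and "norm (homogeneous_part t A X k) \<le> row_norm X ^ k * M"
proof -
  let ?W = "{w :: 'i list. length w = k}"
  let ?f = "\<lambda>z w. homogeneous_term t A X w z"
  let ?a = "\<lambda>z w. (norm (tensor_op t id_blinfun (A w) z))\<^sup>2"
  have a_le: "(\<Sum>w\<in>J. ?a z w) \<le> M\<^sup>2 * (norm z)\<^sup>2" if "finite J" "J \<subseteq> ?W" for J z
    using that A by (intro column_estimate col) auto
  have f_le: "norm (\<Sum>w\<in>J. ?f z w) \<le> row_norm X ^ k * sqrt (\<Sum>w\<in>J. ?a z w)"
    if "finite J" "J \<subseteq> ?W" for J z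
    unfolding homogeneous_term_def
    using that A word_column_le[OF X that] op_tuplesD[OF X] row_norm_nonneg[of X]
    by (intro row_column_estimate) (auto intro: word_op_bounded_ops)
  have f_le': "norm (\<Sum>w\<in>J. ?f z w) \<le> row_norm X ^ k * M * norm z"
    if "finite J" "J \<subseteq> ?W" for J z
  proof -
    have "sqrt (\<Sum>w\<in>J. ?a z w) \<le> M * norm z"
      using a_le[OF that] M by (intro real_le_lsqrt) (auto simp: power_mult_distrib sum_nonneg)
    then have "row_norm X ^ k * sqrt (\<Sum>w\<in>J. ?a z w) \<le> row_norm X ^ k * (M * norm z)"
      using row_norm_nonneg[of X] by (intro mult_left_mono) auto
    then show ?thesis using f_le[OF that, of z] by (simp add: mult.assoc)
  qed
  have "?f z summable_on ?W" for z
  proof (rule summable_on_dominated[where a = "?a z" and c = "row_norm X ^ k"])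
    show "?a z summable_on ?W"
      using a_le by (intro nonneg_bdd_above_summable_on) (auto intro!: bdd_aboveI2)
  qed (use f_le row_norm_nonneg[of X] in auto)
  then have sum: "(?f z has_sum infsum (?f z) ?W) ?W" for z by (rule has_sum_infsum)
  have bl: "bounded_linear (\<lambda>z. infsum (?f z) ?W)"
  proof (rule bounded_linear_intro)
    fix z z' and r :: real
    show "infsum (?f (z + z')) ?W = infsum (?f z) ?W + infsum (?f z') ?W"
      by (rule infsumI) (auto simp: blinfun.add_right intro!: has_sum_add sum)
    show "infsum (?f (r *\<^sub>R z)) ?W = r *\<^sub>R infsum (?f z) ?W"
      by (rule infsumI)
        (auto simp: blinfun.scaleR_right intro!: has_sum_bounded_linear[OF bounded_linear_scaleR_right] sum)
    show "norm (infsum (?f z) ?W) \<le> norm z * (row_norm X ^ k * M)"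
      by (rule has_sum_norm_le[OF sum]) (use f_le' in \<open>auto simp: mult_ac\<close>)
  qed
  define T where "T = Blinfun (\<lambda>z. infsum (?f z) ?W)"
  have T: "has_strong_sum (homogeneous_term t A X) T ?W"
    using sum by (simp add: has_strong_sum_def T_def bounded_linear_Blinfun_apply[OF bl])
  then show "strongly_summable (homogeneous_term t A X) ?W" by (auto simp: strongly_summable_def)
  have "norm T \<le> row_norm X ^ k * M"
  proof (rule norm_blinfun_bound)
    show "norm (T z) \<le> row_norm X ^ k * M * norm z" for z
      by (rule has_sum_norm_le[OF has_strong_sumD[OF T]]) (use f_le' in auto)
  qed (use M row_norm_nonneg[of X] in auto)
  then show "norm (homogeneous_part t A X k) \<le> row_norm X ^ k * M"
    unfolding homogeneous_part_def strong_sum_eqI[OF T] .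
qed


section \<open>Copies of the creation operators\<close>

lemma cinner_ell2_basis: "cinner f (ell2_basis w) = ell2_coeff f w"
proof -
  have "((\<lambda>j. ell2_coeff f j * cnj (ell2_coeff (ell2_basis w) j)) has_sum ell2_coeff f w) UNIV"
    by (rule has_sum_finite_neutralI[of "{w}"]) (auto simp: ell2_basis.rep_eq)
  then show ?thesis unfolding cinner_ell2_def by (rule infsumI)
qed

lemma orthonormal_ell2_basis: "orthonormal_on UNIV ell2_basis"
  by (simp add: orthonormal_on_def cinner_ell2_basis ell2_basis.rep_eq)

lemma left_creation_basis: "left_creation i (ell2_basis w) = ell2_basis (i # w)"
  by (rule ell2_eqI)
    (auto simp: left_creation.rep_eq fock_tensor.rep_eq ell2_basis.rep_eq split: list.splits)

lemma cadjoint_left_creation_coeff: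
  "ell2_coeff (cadjoint (left_creation i) f) w = ell2_coeff f (i # w)"
  by (metis cinner_ell2_basis cinner_cadjoint' left_creation_basis left_creation_bounded_ops)

lemma left_creation_orthogonal:
  assumes "i \<noteq> j"
  shows "cinner (left_creation i f) (left_creation j g) = 0"
  unfolding cinner_ell2_def
  by (rule infsum_0) (use assms in \<open>auto simp: left_creation.rep_eq fock_tensor.rep_eq
      ell2_basis.rep_eq split: list.splits\<close>)

lemma norm_left_creation: "norm (left_creation i f) = norm f"
proof -
  have "cinner (ell2_basis i) (ell2_basis i) = 1"
    by (simp add: cinner_ell2_basis ell2_basis.rep_eq)
  then show ?thesis by (simp add: left_creation.rep_eq norm_fock_tensor norm_eq_1_cinner)
qed

text \<open>The hypotheses say that \<open>sum v I\<close> is the orthogonal projection of \<open>q\<close> to the span of the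
  \<open>v i\<close> with \<open>i \<in> I\<close>; the squared distance to \<open>q\<close> is then the remainder of the series of squared norms.\<close>

lemma has_sum_orthogonal:
  fixes v :: "'j \<Rightarrow> 'a::complex_inner"
  assumes orth: "\<And>i j. i \<noteq> j \<Longrightarrow> cinner (v i) (v j) = 0"
    and q: "\<And>j. cinner q (v j) = of_real ((norm (v j))\<^sup>2)"
    and sum: "((\<lambda>j. (norm (v j))\<^sup>2) has_sum (norm q)\<^sup>2) J"
  shows "(v has_sum q) J"
proof -
  have dist: "(norm (q - sum v I))\<^sup>2 = (norm q)\<^sup>2 - (\<Sum>i\<in>I. (norm (v i))\<^sup>2)" if "finite I" for I
  proof -
    have "(norm (q - sum v I))\<^sup>2 = (norm q)\<^sup>2 - 2 * Re (cinner q (sum v I)) + (norm (sum v I))\<^sup>2"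
      unfolding power2_norm_eq_inner inner_eq_Re_cinner cinner_diff_left cinner_diff_right
      using Re_cinner_commute[of "sum v I" q] by simp
    moreover have "Re (cinner q (sum v I)) = (\<Sum>i\<in>I. (norm (v i))\<^sup>2)"
      by (simp add: cinner_sum_right q)
    moreover have "(norm (sum v I))\<^sup>2 = (\<Sum>i\<in>I. (norm (v i))\<^sup>2)"
      using that orth by (intro norm_sum_orthogonal) auto
    ultimately show ?thesis by simp
  qed
  have "((\<lambda>I. sqrt ((norm q)\<^sup>2 - (\<Sum>i\<in>I. (norm (v i))\<^sup>2))) \<longlongrightarrow> sqrt ((norm q)\<^sup>2 - (norm q)\<^sup>2))
      (finite_subsets_at_top J)"
    using sum unfolding has_sum_def by (intro tendsto_intros)
  moreover have "\<forall>\<^sub>F I in finite_subsets_at_top J.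
      sqrt ((norm q)\<^sup>2 - (\<Sum>i\<in>I. (norm (v i))\<^sup>2)) = norm (q - sum v I)"
    by (intro eventually_finite_subsets_at_top_weakI) (simp flip: dist)
  ultimately have "((\<lambda>I. norm (q - sum v I)) \<longlongrightarrow> 0) (finite_subsets_at_top J)"
    using tendsto_cong by fastforce
  then show ?thesis
    unfolding has_sum_def by (subst tendsto_dist_iff) (simp add: dist_norm norm_minus_commute)
qed

definition vacuum_complement :: "'i fock \<Rightarrow>\<^sub>L 'i fock" where
  "vacuum_complement = Blinfun (\<lambda>f. f - ell2_coeff f [] *\<^sub>C ell2_basis [])"

lemma vacuum_complement_apply:
  "vacuum_complement f = f - ell2_coeff f [] *\<^sub>C ell2_basis []"
proof -
  have "bounded_linear (\<lambda>f :: 'a fock. f - ell2_coeff f [] *\<^sub>C ell2_basis [])"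
  proof (intro bounded_linear_sub bounded_linear_ident)
    show "bounded_linear (\<lambda>f :: 'a fock. ell2_coeff f [] *\<^sub>C ell2_basis [] :: 'a fock)"
    proof (rule bounded_linear_intro)
      show "norm (ell2_coeff f [] *\<^sub>C ell2_basis [] :: 'a fock) \<le> norm f * norm (ell2_basis [] :: 'a fock)"
        for f :: "'a fock"
        unfolding norm_scaleC by (intro mult_right_mono norm_ell2_coeff norm_ge_zero)
    qed (simp_all add: plus_ell2.rep_eq scaleR_scaleC scaleC_ell2.rep_eq scaleC_add_left scaleC_scaleC)
  qed
  then show ?thesis by (simp add: vacuum_complement_def bounded_linear_Blinfun_apply)
qed

lemma vacuum_complement_coeff:
  "ell2_coeff (vacuum_complement f) w = (if w = [] then 0 else ell2_coeff f w)"
  by (simp add: vacuum_complement_apply minus_ell2.rep_eq scaleC_ell2.rep_eq ell2_basis.rep_eq)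

lemma norm_vacuum_complement_le: "norm (vacuum_complement f) \<le> norm f"
proof -
  have "(norm (vacuum_complement f))\<^sup>2 \<le> (norm f)\<^sup>2"
    unfolding norm_ell2 by (intro infsum_mono ell2_summable) (simp add: vacuum_complement_coeff)
  then show ?thesis by (simp add: power2_le_iff_abs_le)
qed

text \<open>The creation operators are isometries with orthogonal ranges, and a basis vector lies in the
  range of \<open>S\<^sub>i\<close> if and only if its word begins with \<open>i\<close>. Only the vacuum is missed.\<close>

lemma left_creation_has_strong_sum:
  "has_strong_sum (\<lambda>i. left_creation i o\<^sub>L cadjoint (left_creation i)) vacuum_complement UNIV"
  unfolding has_strong_sum_def
proof (intro allI has_sum_orthogonal)
  fix f :: "'a fock" and i j :: 'a
  let ?S = "left_creation :: 'a \<Rightarrow> _"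
  show "i \<noteq> j \<Longrightarrow> cinner ((?S i o\<^sub>L cadjoint (?S i)) f) ((?S j o\<^sub>L cadjoint (?S j)) f) = 0"
    by (simp add: left_creation_orthogonal)
  have "cadjoint (?S j) (vacuum_complement f) = cadjoint (?S j) f"
    by (rule ell2_eqI) (simp add: cadjoint_left_creation_coeff vacuum_complement_coeff)
  then show "cinner (vacuum_complement f) ((?S j o\<^sub>L cadjoint (?S j)) f)
      = of_real ((norm ((?S j o\<^sub>L cadjoint (?S j)) f))\<^sup>2)"
    by (simp add: cinner_cadjoint' left_creation_bounded_ops norm_left_creation cinner_self)
  have "((\<lambda>w. (cmod (ell2_coeff (vacuum_complement f) w))\<^sup>2) has_sum (norm (vacuum_complement f))\<^sup>2) UNIV"
    unfolding norm_ell2 by (intro has_sum_infsum ell2_summable)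
  then have "((\<lambda>w. (cmod (ell2_coeff f w))\<^sup>2) has_sum (norm (vacuum_complement f))\<^sup>2)
      (range (\<lambda>(i, v). i # v))"
    by (rule has_sum_cong_neutral[THEN iffD1, rotated -1])
      (auto simp: vacuum_complement_coeff neq_Nil_conv image_iff)
  then have "((\<lambda>(i, v). (cmod (ell2_coeff f (i # v)))\<^sup>2) has_sum (norm (vacuum_complement f))\<^sup>2)
      (UNIV \<times> UNIV)"
    by (subst (asm) has_sum_reindex) (auto simp: inj_on_def o_def case_prod_unfold)
  then have "((\<lambda>i. (norm (cadjoint (?S i) f))\<^sup>2) has_sum (norm (vacuum_complement f))\<^sup>2) UNIV"
  proof (rule has_sum_SigmaD)
    show "((\<lambda>v. case (i, v) of (i, v) \<Rightarrow> (cmod (ell2_coeff f (i # v)))\<^sup>2)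
        has_sum (norm (cadjoint (?S i) f))\<^sup>2) UNIV" for i
      using has_sum_infsum[OF ell2_summable[of "cadjoint (?S i) f"]]
      by (simp add: norm_ell2 cadjoint_left_creation_coeff)
  qed
  then show "((\<lambda>i. (norm ((?S i o\<^sub>L cadjoint (?S i)) f))\<^sup>2) has_sum (norm (vacuum_complement f))\<^sup>2) UNIV"
    by (simp add: norm_left_creation)
qed

text \<open>An isometry \<open>V\<close> of the Fock space into a Hilbert space carries the creation operators over to
  operators \<open>V S\<^sub>i V\<^sup>*\<close> on that Hilbert space.\<close>

definition transported_creation ::
  "('i fock \<Rightarrow>\<^sub>L 'a::chilbert_space) \<Rightarrow> real \<Rightarrow> 'i \<Rightarrow> ('a \<Rightarrow>\<^sub>L 'a)" where
  "transported_creation V \<rho> i = \<rho> *\<^sub>R (V o\<^sub>L left_creation i o\<^sub>L cadjoint V)"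

locale fock_isometry =
  fixes V :: "'i::countable fock \<Rightarrow>\<^sub>L 'a::chilbert_space"
  assumes V: "V \<in> bounded_ops" and isometry: "cadjoint V o\<^sub>L V = id_blinfun"
begin

lemma cadjoint_V_V: "cadjoint V (V f) = f"
  using isometry by (metis blinfun_apply_blinfun_compose id_blinfun.rep_eq)

lemma norm_V: "norm (V f) = norm f"
proof -
  have "cinner (V f) (V f) = cinner f f" by (simp add: cinner_cadjoint V cadjoint_V_V)
  then show ?thesis unfolding cinner_self of_real_eq_iff by (simp add: power2_eq_iff_nonneg)
qed

lemma norm_cadjoint_V_le: "norm (cadjoint V x) \<le> norm x"
proof -
  have "(norm (cadjoint V x))\<^sup>2 = Re (cinner (V (cadjoint V x)) x)"
    by (simp add: cinner_cadjoint V power2_norm_eq_inner inner_eq_Re_cinner)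
  also have "\<dots> \<le> norm (cadjoint V x) * norm x"
    using complex_Re_le_cmod norm_cinner_le norm_V by (metis order_trans)
  finally show ?thesis by (cases "norm (cadjoint V x) = 0") (auto simp: power2_eq_square)
qed

lemma transported_creation_bounded_ops: "transported_creation V \<rho> i \<in> bounded_ops"
  unfolding transported_creation_def
  by (intro bounded_ops_scaleR bounded_ops_compose cadjoint_bounded_ops V left_creation_bounded_ops)

lemma transported_creation_basis:
  "transported_creation V \<rho> i (V (ell2_basis w)) = \<rho> *\<^sub>R V (ell2_basis (i # w))"
  by (simp add: transported_creation_def blinfun.scaleR_left cadjoint_V_V left_creation_basis)

lemma orthonormal_V_basis: "orthonormal_on UNIV (\<lambda>w. V (ell2_basis w))"
  using orthonormal_ell2_basis
  by (simp add: orthonormal_on_def cinner_cadjoint V cadjoint_V_V)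

lemma transported_creation_has_strong_sum:
  "has_strong_sum (\<lambda>i. transported_creation V \<rho> i o\<^sub>L cadjoint (transported_creation V \<rho> i))
    (\<rho>\<^sup>2 *\<^sub>R (V o\<^sub>L vacuum_complement o\<^sub>L cadjoint V)) UNIV"
proof -
  have eq: "(transported_creation V \<rho> i o\<^sub>L cadjoint (transported_creation V \<rho> i)) x
    = \<rho>\<^sup>2 *\<^sub>R V ((left_creation i o\<^sub>L cadjoint (left_creation i)) (cadjoint V x))" for i x
    unfolding transported_creation_def
    by (simp add: cadjoint_scaleR cadjoint_compose bounded_ops_compose cadjoint_bounded_ops V
        left_creation_bounded_ops cadjoint_cadjoint blinfun.scaleR_left blinfun.scaleR_right
        cadjoint_V_V power2_eq_square)
  show ?thesis
    unfolding has_strong_sum_def eq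
    by (auto simp: blinfun.scaleR_left
        intro!: has_sum_bounded_linear[OF bounded_linear_scaleR_right]
          has_sum_bounded_linear[OF blinfun.bounded_linear_right]
          has_strong_sumD[OF left_creation_has_strong_sum, simplified])
qed

lemma transported_creation_op_tuples: "transported_creation V \<rho> \<in> op_tuples"
  using transported_creation_has_strong_sum transported_creation_bounded_ops
  by (auto simp: op_tuples_def strongly_summable_def)

lemma row_norm_transported_creation: "row_norm (transported_creation V \<rho>) = \<bar>\<rho>\<bar>"
proof -
  define T where "T = V o\<^sub>L vacuum_complement o\<^sub>L cadjoint V"
  have "norm T \<le> 1"
    by (rule norm_blinfun_bound)
      (use norm_vacuum_complement_le norm_cadjoint_V_le in
        \<open>auto simp: T_def norm_V intro: order_trans\<close>)
  moreover have "1 \<le> norm T"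
  proof -
    fix i :: 'i
    have "vacuum_complement (ell2_basis [i]) = ell2_basis [i]"
      by (rule ell2_eqI) (auto simp: vacuum_complement_coeff ell2_basis.rep_eq)
    then have "T (V (ell2_basis [i])) = V (ell2_basis [i])" by (simp add: T_def cadjoint_V_V)
    moreover have "norm (V (ell2_basis [i])) = 1"
      using orthonormal_V_basis by (intro norm_eq_1_cinner) (simp add: orthonormal_on_def)
    ultimately show ?thesis using norm_blinfun[of T "V (ell2_basis [i])"] by simp
  qed
  ultimately show ?thesis
    unfolding row_norm_def strong_sum_eqI[OF transported_creation_has_strong_sum] T_def[symmetric]
    by simp
qed

end

lemma fock_isometry_id: "fock_isometry (id_blinfun :: 'i::countable fock \<Rightarrow>\<^sub>L 'i fock)"
proof
  show "id_blinfun \<in> (bounded_ops :: ('i fock \<Rightarrow>\<^sub>L 'i fock) set)" by (rule bounded_ops_id)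
  show "cadjoint (id_blinfun :: 'i fock \<Rightarrow>\<^sub>L 'i fock) o\<^sub>L id_blinfun = id_blinfun"
    unfolding cadjoint_id by (rule blinfun_eqI) simp
qed

lemma transported_creation_id: "transported_creation id_blinfun \<rho> = (\<lambda>i. \<rho> *\<^sub>R left_creation i)"
  by (intro ext blinfun_eqI) (simp add: transported_creation_def cadjoint_id blinfun.scaleR_left)

text \<open>The map from \<open>x\<close> to the family of its coefficients with respect to \<open>h\<close> is bounded by Bessel's
  inequality. The isometry is its adjoint, which avoids summing vectors of \<open>'a\<close>.\<close>

lemma orthonormal_words_imp_fock_isometry:
  fixes h :: "'i::countable list \<Rightarrow> 'a::chilbert_space"
  assumes h: "orthonormal_on UNIV h"
  shows "\<exists>V :: 'i fock \<Rightarrow>\<^sub>L 'a. fock_isometry V"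
proof -
  have fin: "(\<Sum>w\<in>J. (cmod (cinner x (h w)))\<^sup>2) \<le> (norm x)\<^sup>2" if "finite J" for J x
    using that h by (intro Bessel_inequality) (auto simp: orthonormal_on_def)
  have sq: "(\<lambda>w. (cmod (cinner x (h w)))\<^sup>2) summable_on UNIV" for x
    using fin by (intro nonneg_bdd_above_summable_on) (auto intro!: bdd_aboveI2)
  define W where "W x = Abs_ell2 (\<lambda>w. cinner x (h w))" for x
  have coeff: "ell2_coeff (W x) w = cinner x (h w)" for x w
    unfolding W_def using sq by (subst Abs_ell2_inverse) auto
  have bl: "bounded_linear W"
  proof (rule bounded_linear_intro)
    show "W (x + y) = W x + W y" for x y
      by (rule ell2_eqI) (simp add: coeff plus_ell2.rep_eq cinner_add_left)
    show "W (r *\<^sub>R x) = r *\<^sub>R W x" for r x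
      by (rule ell2_eqI) (simp add: coeff scaleR_scaleC scaleC_ell2.rep_eq cinner_scaleC_left)
    have "(norm (W x))\<^sup>2 \<le> (norm x)\<^sup>2" for x
      unfolding norm_ell2 coeff by (rule infsum_le_finite_sums[OF sq fin])
    then show "norm (W x) \<le> norm x * 1" for x by (simp add: power2_le_iff_abs_le)
  qed
  define B where "B = Blinfun W"
  have B: "B x = W x" for x by (simp add: B_def bounded_linear_Blinfun_apply[OF bl])
  have "W (c *\<^sub>C x) = c *\<^sub>C W x" for c x
    by (rule ell2_eqI) (simp add: coeff scaleC_ell2.rep_eq cinner_scaleC_left)
  then have bop: "B \<in> bounded_ops" by (simp add: bounded_ops_def B)
  have "W (h w) = ell2_basis w" for w
    using h by (intro ell2_eqI) (auto simp: coeff ell2_basis.rep_eq orthonormal_on_def)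
  then have "(B o\<^sub>L cadjoint B) f = f" for f
    by (intro ell2_eqI)
      (simp add: B coeff cinner_ell2_basis flip: cinner_cadjoint'[OF bop, of f "h _"]
        cinner_cadjoint'[OF bop])
  then have "fock_isometry (cadjoint B)"
    using bop by unfold_locales
      (auto intro!: blinfun_eqI simp: cadjoint_bounded_ops cadjoint_cadjoint)
  then show ?thesis by blast
qed

lemma infinite_dimensional_imp_fock_isometry:
  assumes "infinite_dimensional TYPE('a::chilbert_space)"
  shows "\<exists>V :: 'i::countable fock \<Rightarrow>\<^sub>L 'a. fock_isometry V"
proof -
  obtain h :: "nat \<Rightarrow> 'a" where "orthonormal_on UNIV h"
    using infinite_dimensional_orthonormal_sequence[OF assms] by blast
  then have "orthonormal_on UNIV (\<lambda>w :: 'i list. h (to_nat w))"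
    by (simp add: orthonormal_on_def)
  then show ?thesis by (rule orthonormal_words_imp_fock_isometry)
qed


section \<open>Matrix coefficients of a free holomorphic function\<close>

lemma word_op_shift:
  assumes "\<And>i w. blinfun_apply (X i) (h w) = \<rho> *\<^sub>R h (i # w)"
  shows "blinfun_apply (word_op X b) (h v) = \<rho> ^ length b *\<^sub>R h (b @ v)"
  by (induction b) (simp_all add: assms blinfun.scaleR_right mult.commute)

lemma le_square_quotient:
  fixes c :: real
  assumes "c > 0" "c\<^sup>2 * x \<le> (a * b)\<^sup>2"
  shows "x \<le> (a / c)\<^sup>2 * b\<^sup>2"
  using assms by (simp add: power_divide power_mult_distrib pos_le_divide_eq mult_ac)

text \<open>Operators acting like multiples of the creation operators on an orthonormal family indexed
  by the words: the creation operators themselves and their copies on other Hilbert spaces.\<close>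

locale weighted_shift = tensor t
  for t :: "'a::chilbert_space \<Rightarrow> 'b::chilbert_space \<Rightarrow> 'k::chilbert_space" +
  fixes A :: "'i::countable list \<Rightarrow> 'b \<Rightarrow>\<^sub>L 'b" and X :: "'i \<Rightarrow> 'a \<Rightarrow>\<^sub>L 'a"
    and h :: "'i list \<Rightarrow> 'a" and \<rho> :: real
  assumes A: "A w \<in> bounded_ops" and X: "X i \<in> bounded_ops"
    and h: "orthonormal_on UNIV h" and shift: "X i (h w) = \<rho> *\<^sub>R h (i # w)"
    and pos: "\<rho> > 0"
    and summable: "strongly_summable (homogeneous_term t A X) {w. length w = k}"
begin

lemma cinner_h: "cinner (h v) (h w) = (if v = w then 1 else 0)"
  using h by (simp add: orthonormal_on_def)

lemma norm_h: "norm (h w) = 1"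
  by (rule norm_eq_1_cinner) (simp add: cinner_h)

lemma norm_sum_h:
  assumes "finite J"
  shows "(norm (\<Sum>w\<in>J. t (h w) (g w)))\<^sup>2 = (\<Sum>w\<in>J. (norm (g w))\<^sup>2)"
proof -
  have "(norm (\<Sum>w\<in>J. t (h w) (g w)))\<^sup>2 = (\<Sum>w\<in>J. (norm (t (h w) (g w)))\<^sup>2)"
    using assms by (intro norm_sum_orthogonal) (auto simp: cinner_t cinner_h)
  then show ?thesis by (simp add: norm_t norm_h)
qed

lemma homogeneous_part_has_strong_sum:
  "has_strong_sum (homogeneous_term t A X) (homogeneous_part t A X k) {w. length w = k}"
  unfolding homogeneous_part_def by (rule has_strong_sum_strong_sum[OF summable])

lemma homogeneous_part_bounded_ops: "homogeneous_part t A X k \<in> bounded_ops"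
  by (rule has_strong_sum_bounded_ops[OF homogeneous_part_has_strong_sum])
    (simp add: homogeneous_term_def tensor_op_bounded_ops word_op_bounded_ops A X)

text \<open>The only word that contributes to this matrix entry is the one that extends \<open>v\<close> on the left
  to \<open>w\<close>.\<close>

lemma homogeneous_part_coefficient:
  "cinner (homogeneous_part t A X j (t (h v) y)) (t (h w) z)
    = (if length w = j + length v \<and> drop j w = v then of_real (\<rho> ^ j) * cinner (A (take j w) y) z else 0)"
    (is "_ = ?c")
proof (rule has_sum_unique)
  let ?f = "\<lambda>b. cinner (homogeneous_term t A X b (t (h v) y)) (t (h w) z)"
  show "(?f has_sum cinner (homogeneous_part t A X j (t (h v) y)) (t (h w) z)) {b. length b = j}"
    by (intro has_sum_bounded_linear[OF bounded_linear_cinner_left]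
        has_strong_sumD[OF homogeneous_part_has_strong_sum])
  have f: "?f b = (if b @ v = w then of_real (\<rho> ^ length b) * cinner (A b y) z else 0)" for b
    by (simp add: homogeneous_term_def tensor_op_apply word_op_bounded_ops A X word_op_shift[of X h \<rho>, OF shift]
        t_scaleR_left cinner_scaleR_left cinner_t cinner_h)
  show "(?f has_sum ?c) {b. length b = j}"
  proof (cases "length w = j + length v \<and> drop j w = v")
    case True
    then have w: "take j w @ v = w" "length (take j w) = j"
      using append_take_drop_id[of j w] by auto
    show ?thesis
    proof (rule has_sum_finite_neutralI)
      show "finite {take j w}" "{take j w} \<subseteq> {b. length b = j}" using w by auto
      show "?c = sum ?f {take j w}" unfolding f using True w by simp
      fix b assume "b \<in> {b. length b = j} - {take j w}"
      then have "b @ v \<noteq> w" by auto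
      then show "?f b = 0" unfolding f by simp
    qed
  next
    case False
    have "?f b = 0" if "b \<in> {b. length b = j}" for b
    proof -
      have "b @ v \<noteq> w" using False that by auto
      then show ?thesis unfolding f by simp
    qed
    then show ?thesis unfolding if_not_P[OF False] by (rule has_sum_0)
  qed
qed

text \<open>If \<open>w\<close> is shorter than \<open>v\<close>, the truncated difference of the lengths is \<open>0\<close> and the condition
  fails, as it should: no term of the series lowers the degree.\<close>

lemma free_series_coefficient:
  assumes T: "homogeneous_part t A X sums T"
  shows "cinner (T (t (h v) y)) (t (h w) z)
    = (if drop (length w - length v) w = v
       then of_real (\<rho> ^ (length w - length v)) * cinner (A (take (length w - length v) w) y) z else 0)"
    (is "_ = ?c")
proof (rule sums_unique2)
  let ?f = "\<lambda>j. cinner (homogeneous_part t A X j (t (h v) y)) (t (h w) z)"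
  have "bounded_linear (\<lambda>R. cinner (blinfun_apply R (t (h v) y)) (t (h w) z))"
    by (intro bounded_linear_compose[OF bounded_linear_cinner_left] blinfun.bounded_linear_left)
  then show "?f sums cinner (T (t (h v) y)) (t (h w) z)"
    using T by (rule bounded_linear.sums)
  have "?f = (\<lambda>j. if j = length w - length v then ?c else 0)"
  proof
    fix j
    have "length w = j + length v \<and> drop j w = v \<longleftrightarrow>
        j = length w - length v \<and> drop (length w - length v) w = v"
    proof
      assume *: "j = length w - length v \<and> drop (length w - length v) w = v"
      then have "length w - (length w - length v) = length v" by (metis length_drop)
      with * show "length w = j + length v \<and> drop j w = v" by auto
    qed auto
    then show "?f j = (if j = length w - length v then ?c else 0)"
      unfolding homogeneous_part_coefficient by auto
  qed
  then show "?f sums ?c" using sums_single[of "length w - length v" "\<lambda>_. ?c"] by simp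
qed

text \<open>The homogeneous part maps \<open>h [] \<otimes> x\<close> to the orthogonal sum of the vectors
  \<open>\<rho>\<^sup>k h w \<otimes> A w x\<close>.\<close>

lemma column_le_norm_homogeneous_part:
  assumes J: "finite J" "J \<subseteq> {w. length w = k}" and K: "norm (homogeneous_part t A X k) \<le> K"
  shows "(\<Sum>w\<in>J. (norm (A w x))\<^sup>2) \<le> (K / \<rho> ^ k)\<^sup>2 * (norm x)\<^sup>2"
proof -
  define g where "g w = \<rho> ^ k *\<^sub>R A w x" for w
  define p where "p = (\<Sum>w\<in>J. t (h w) (g w))"
  let ?C = "homogeneous_part t A X k (t (h []) x)"
  have "cinner ?C p = (\<Sum>w\<in>J. cinner (g w) (g w))"
    unfolding p_def cinner_sum_right using J
    by (intro sum.cong) (auto simp: homogeneous_part_coefficient g_def cinner_scaleR_left)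
  also have "\<dots> = of_real ((norm p)\<^sup>2)" unfolding p_def norm_sum_h[OF J(1)] by (simp add: cinner_self)
  finally have "(norm p)\<^sup>2 = cmod (cinner ?C p)" by (simp add: norm_power)
  also have "\<dots> \<le> norm ?C * norm p" by (rule norm_cinner_le)
  also have "\<dots> \<le> K * norm x * norm p"
  proof (rule mult_right_mono)
    have "norm ?C \<le> norm (homogeneous_part t A X k) * norm (t (h []) x)" by (rule norm_blinfun)
    also have "\<dots> \<le> K * norm x" using K by (simp add: norm_t norm_h mult_right_mono)
    finally show "norm ?C \<le> K * norm x" .
  qed simp
  finally have "norm p * norm p \<le> (K * norm x) * norm p" by (simp add: power2_eq_square)
  moreover have "0 \<le> K * norm x" using order_trans[OF norm_ge_zero K] by simp
  ultimately have "norm p \<le> K * norm x" by (cases "norm p = 0") (auto simp: mult_le_cancel_right)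
  then have "(norm p)\<^sup>2 \<le> (K * norm x)\<^sup>2" by (intro power_mono) auto
  then have "(\<rho> ^ k)\<^sup>2 * (\<Sum>w\<in>J. (norm (A w x))\<^sup>2) \<le> (K * norm x)\<^sup>2"
    unfolding p_def norm_sum_h[OF J(1)] g_def using pos
    by (simp add: power_mult_distrib sum_distrib_left)
  then show ?thesis using pos by (intro le_square_quotient) simp_all
qed

text \<open>The coefficient estimate behind the theorem. The upper bound for the real part is tested on
  \<open>p + c q\<close>, where \<open>p = h [] \<otimes> x\<close> and \<open>q\<close> is the component of degree \<open>k\<close> of \<open>T p\<close>, cut down to
  finitely many words. As \<open>T\<close> never lowers degrees, the two diagonal entries involve the constant
  coefficient only, one off-diagonal entry is \<open>norm q ^ 2\<close> and the other one vanishes; the choice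
  \<open>c = norm p / norm q\<close> balances the terms.\<close>

lemma column_le_real_part_bound:
  assumes T: "homogeneous_part t A X sums T"
    and a: "\<And>y. Re (cinner (T y) y) \<le> a * (norm y)\<^sup>2"
    and b: "\<And>y. norm (A [] y) \<le> b * norm y"
    and k: "k > 0" and J: "finite J" "J \<subseteq> {w. length w = k}"
  shows "(\<Sum>w\<in>J. (norm (A w x))\<^sup>2) \<le> (2 * (a + b) / \<rho> ^ k)\<^sup>2 * (norm x)\<^sup>2"
proof -
  define g where "g w = \<rho> ^ k *\<^sub>R A w x" for w
  define p q where "p = t (h []) x" and "q = (\<Sum>w\<in>J. t (h w) (g w))"
  note coeff = free_series_coefficient[OF T]
  have ng: "(norm q)\<^sup>2 = (\<Sum>w\<in>J. (norm (g w))\<^sup>2)" unfolding q_def by (rule norm_sum_h[OF J(1)])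
  have len: "w \<noteq> []" "length w = k" if "w \<in> J" for w using that J k by auto
  have pp: "cinner (T p) p = cinner (A [] x) x" by (simp add: p_def coeff)
  have pq: "cinner (T p) q = of_real ((norm q)\<^sup>2)"
  proof -
    have "cinner (T p) q = (\<Sum>w\<in>J. cinner (g w) (g w))"
      unfolding p_def q_def cinner_sum_right
      by (intro sum.cong) (auto simp: coeff len g_def cinner_scaleR_left)
    then show ?thesis by (simp add: ng cinner_self)
  qed
  have qp: "cinner (T q) p = 0"
    unfolding p_def q_def blinfun.sum_right cinner_sum_left
    by (intro sum.neutral) (auto simp: coeff dest: len)
  have qq: "cinner (T q) q = (\<Sum>w\<in>J. cinner (A [] (g w)) (g w))"
  proof -
    have "cinner (T q) q = (\<Sum>v\<in>J. \<Sum>w\<in>J. cinner (T (t (h v) (g v))) (t (h w) (g w)))"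
      unfolding q_def blinfun.sum_right cinner_sum_left by (simp add: cinner_sum_right)
    also have "\<dots> = (\<Sum>v\<in>J. \<Sum>w\<in>J. if v = w then cinner (A [] (g v)) (g v) else 0)"
      by (intro sum.cong) (auto simp: coeff len)
    finally show ?thesis using J(1) by simp
  qed
  have cpq: "cinner p q = 0"
    unfolding p_def q_def cinner_sum_right using len by (intro sum.neutral) (auto simp: cinner_t cinner_h)
  have lower: "- (b * (norm y)\<^sup>2) \<le> Re (cinner (A [] y) y)" for y
    by (rule Re_cinner_ge[OF b])
  have key: "c * (norm q)\<^sup>2 \<le> (a + b) * ((norm x)\<^sup>2 + c\<^sup>2 * (norm q)\<^sup>2)" for c :: real
  proof -
    let ?y = "p + c *\<^sub>R q"
    have "Re (cinner (T ?y) ?y) = Re (cinner (A [] x) x) + c * (norm q)\<^sup>2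
        + c\<^sup>2 * (\<Sum>w\<in>J. Re (cinner (A [] (g w)) (g w)))"
      by (simp add: blinfun.add_right blinfun.scaleR_right cinner_add_left cinner_add_right
          cinner_scaleR_left cinner_scaleR_right pp pq qp qq)
        (simp add: power2_eq_square algebra_simps)
    moreover have "(norm ?y)\<^sup>2 = (norm x)\<^sup>2 + c\<^sup>2 * (norm q)\<^sup>2"
    proof -
      have "inner p q = 0" using cpq by (simp add: inner_eq_Re_cinner)
      then have "(norm ?y)\<^sup>2 = (norm p)\<^sup>2 + c\<^sup>2 * (norm q)\<^sup>2"
        by (simp add: power2_norm_eq_inner inner_add_left inner_add_right inner_commute[of q p])
          (simp add: power2_eq_square)
      then show ?thesis by (simp add: p_def norm_t norm_h)
    qed
    moreover have "- (b * (norm q)\<^sup>2) \<le> (\<Sum>w\<in>J. Re (cinner (A [] (g w)) (g w)))"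
      unfolding ng sum_distrib_left sum_negf[symmetric] by (intro sum_mono lower)
    then have "c\<^sup>2 * - (b * (norm q)\<^sup>2) \<le> c\<^sup>2 * (\<Sum>w\<in>J. Re (cinner (A [] (g w)) (g w)))"
      by (rule mult_left_mono) simp
    ultimately show ?thesis
      using a[of ?y] lower[of x] by (simp add: algebra_simps)
  qed
  have "(norm q)\<^sup>2 \<le> (2 * (a + b) * norm x)\<^sup>2"
  proof (cases "norm q = 0")
    case False
    then have "x \<noteq> 0" by (auto simp: q_def g_def t_zero_right)
    then have pos: "norm x > 0" "norm q > 0" using False by auto
    have "norm x * norm q \<le> (a + b) * (2 * (norm x)\<^sup>2)"
      using key[of "norm x / norm q"] pos by (simp add: power_divide power2_eq_square)
    then have "norm q * norm x \<le> (2 * (a + b) * norm x) * norm x"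
      by (simp add: power2_eq_square mult_ac)
    then have "norm q \<le> 2 * (a + b) * norm x" using pos by (simp add: mult_le_cancel_right)
    then show ?thesis by (intro power_mono) auto
  qed simp
  then have "(\<rho> ^ k)\<^sup>2 * (\<Sum>w\<in>J. (norm (A w x))\<^sup>2) \<le> (2 * (a + b) * norm x)\<^sup>2"
    unfolding ng g_def using pos by (simp add: power_mult_distrib sum_distrib_left)
  then show ?thesis using pos by (intro le_square_quotient) simp_all
qed

end


section \<open>Free holomorphic functions on the ball\<close>

lemma free_holomorphic_onD:
  assumes "free_holomorphic_on t s A F"
  shows "A w \<in> bounded_ops"
    and "X \<in> row_ball s \<Longrightarrow> strongly_summable (homogeneous_term t A X) {w. length w = k}"
    and "X \<in> row_ball s \<Longrightarrow> homogeneous_part t A X sums F X"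
  using assms unfolding free_holomorphic_on_def by blast+

lemma homogeneous_part_0: "homogeneous_part t A X 0 = tensor_op t id_blinfun (A [])"
proof -
  have "{w. length w = 0} = {[]}" by auto
  moreover have "has_strong_sum (homogeneous_term t A X) (homogeneous_term t A X []) {[]}"
    unfolding has_strong_sum_def by (auto intro: has_sum_finiteI)
  ultimately show ?thesis
    by (simp add: homogeneous_part_def strong_sum_eqI homogeneous_term_def)
qed

lemma has_strong_sum_zero: "has_strong_sum (\<lambda>j. 0) 0 J"
  by (simp add: has_strong_sum_def)

lemma zero_in_row_ball:
  assumes "s > 0"
  shows "(\<lambda>_. 0) \<in> row_ball s"
proof -
  have "0 \<in> (bounded_ops :: ('b::chilbert_space \<Rightarrow>\<^sub>L 'b) set)" by (simp add: bounded_ops_def)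
  then show ?thesis
    using assms
    by (auto simp: row_ball_def op_tuples_def row_norm_def strongly_summable_def
        strong_sum_eqI[OF has_strong_sum_zero] intro: has_strong_sum_zero)
qed

lemma (in tensor) free_holomorphic_at_0:
  assumes F: "free_holomorphic_on t s A F" and "s > 0"
  shows "F (\<lambda>_. 0) = tensor_op t id_blinfun (A [])"
proof (rule sums_unique2)
  let ?Z = "\<lambda>_ :: 'i::countable. 0 :: 'a \<Rightarrow>\<^sub>L 'a"
  show "homogeneous_part t A ?Z sums F ?Z"
    by (rule free_holomorphic_onD(3)[OF F zero_in_row_ball[OF \<open>s > 0\<close>]])
  have "homogeneous_part t A ?Z k = 0" if "k \<noteq> 0" for k
  proof -
    have "homogeneous_term t A ?Z w = 0" if "length w = k" for w
    proof -
      from that \<open>k \<noteq> 0\<close> have "word_op ?Z w = 0" by (cases w) (auto simp:)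
      then show ?thesis
        unfolding homogeneous_term_def
        by (intro tensor_op_eqI) (simp_all add: bounded_ops_def t_zero_left)
    qed
    then have "has_strong_sum (homogeneous_term t A ?Z) 0 {w. length w = k}"
      by (auto simp: has_strong_sum_def intro!: has_sum_0)
    then show ?thesis unfolding homogeneous_part_def by (rule strong_sum_eqI)
  qed
  then show "homogeneous_part t A ?Z sums tensor_op t id_blinfun (A [])"
    using sums_finite[of "{0}" "homogeneous_part t A ?Z"] by (simp add: homogeneous_part_0)
qed

text \<open>The estimate comes from a copy of \<open>\<sigma> S\<close> on \<open>'h\<close>, where the terms of a convergent series are
  bounded. For \<open>\<gamma> < \<sigma>\<close> it makes the series at \<open>\<gamma> S\<close> converge geometrically.\<close>

lemma free_holomorphic_column_bound:
  fixes t :: "'h::chilbert_space \<Rightarrow> 'e::chilbert_space \<Rightarrow> 'k::chilbert_space"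
    and A :: "'i::countable list \<Rightarrow> 'e \<Rightarrow>\<^sub>L 'e"
  assumes t: "hilbert_tensor t" and inf: "infinite_dimensional TYPE('h)"
    and F: "free_holomorphic_on t s A F" and \<sigma>: "0 < \<sigma>" "\<sigma> < s"
  shows "\<exists>K\<ge>0. \<forall>k J x. finite J \<longrightarrow> J \<subseteq> {w. length w = k} \<longrightarrow>
    (\<Sum>w\<in>J. (norm (A w x))\<^sup>2) \<le> (K / \<sigma> ^ k)\<^sup>2 * (norm x)\<^sup>2"
proof -
  obtain V :: "'i fock \<Rightarrow>\<^sub>L 'h" where "fock_isometry V"
    using infinite_dimensional_imp_fock_isometry[OF inf] by blast
  then interpret fock_isometry V .
  let ?X = "transported_creation V \<sigma>"
  have ball: "?X \<in> row_ball s"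
    using \<sigma> by (simp add: row_ball_def transported_creation_op_tuples row_norm_transported_creation)
  interpret weighted_shift t A ?X "\<lambda>w. V (ell2_basis w)" \<sigma>
    by unfold_locales (use t free_holomorphic_onD[OF F] ball \<sigma> orthonormal_V_basis in
      \<open>auto simp: transported_creation_bounded_ops transported_creation_basis\<close>)
  have "homogeneous_part t A ?X \<longlonglongrightarrow> 0"
    using free_holomorphic_onD(3)[OF F ball] by (intro summable_LIMSEQ_zero) (rule sums_summable)
  then have "Bseq (homogeneous_part t A ?X)" by (intro convergent_imp_Bseq convergentI)
  then obtain K where K: "K > 0" "\<And>k. norm (homogeneous_part t A ?X k) \<le> K"
    by (auto elim: BseqE)
  show ?thesis
  proof (intro exI[of _ K] conjI allI impI)
    show "0 \<le> K" using K(1) by simp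
  qed (rule column_le_norm_homogeneous_part[OF _ _ K(2)])
qed

lemma weighted_shift_creation:
  fixes t :: "'i::countable fock \<Rightarrow> 'e::chilbert_space \<Rightarrow> 'm::chilbert_space"
  assumes "hilbert_tensor t" "\<And>w. A w \<in> bounded_ops" "\<gamma> > 0"
    "\<And>k. strongly_summable (homogeneous_term t A (\<lambda>i. \<gamma> *\<^sub>R left_creation i)) {w. length w = k}"
  shows "weighted_shift t A (\<lambda>i. \<gamma> *\<^sub>R left_creation i) ell2_basis \<gamma>"
  by unfold_locales (use assms in \<open>auto simp: bounded_ops_scaleR left_creation_bounded_ops
    orthonormal_ell2_basis blinfun.scaleR_left left_creation_basis\<close>)

lemma free_series_on_fock_converges:
  fixes t :: "'i::countable fock \<Rightarrow> 'e::chilbert_space \<Rightarrow> 'm::chilbert_space"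
  assumes t: "hilbert_tensor t" and A: "\<And>w. A w \<in> bounded_ops" and K: "K \<ge> 0"
    and col: "\<And>k J x. finite J \<Longrightarrow> J \<subseteq> {w. length w = k} \<Longrightarrow>
      (\<Sum>w\<in>J. (norm (A w x))\<^sup>2) \<le> (K / \<sigma> ^ k)\<^sup>2 * (norm x)\<^sup>2"
    and \<gamma>: "0 < \<gamma>" "\<gamma> < \<sigma>"
  shows "strongly_summable (homogeneous_term t A (\<lambda>i. \<gamma> *\<^sub>R left_creation i)) {w. length w = k}"
    and "homogeneous_part t A (\<lambda>i. \<gamma> *\<^sub>R left_creation i)
      sums free_eval t A (\<lambda>i. \<gamma> *\<^sub>R left_creation i)"
proof -
  interpret tensor t using t by unfold_locales
  let ?X = "\<lambda>i :: 'i. \<gamma> *\<^sub>R left_creation i"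
  have X: "?X \<in> op_tuples" "row_norm ?X = \<gamma>"
    using fock_isometry.transported_creation_op_tuples[OF fock_isometry_id, of \<gamma>]
      fock_isometry.row_norm_transported_creation[OF fock_isometry_id, of \<gamma>] \<gamma>
    by (simp_all add: transported_creation_id)
  have M: "K / \<sigma> ^ k \<ge> 0" for k using K \<gamma> by simp
  note est = homogeneous_part_estimate[where X = ?X, OF X(1) A M col]
  show "strongly_summable (homogeneous_term t A ?X) {w. length w = k}" by (rule est(1))
  have "summable (homogeneous_part t A ?X)"
  proof (rule summable_comparison_test')
    show "summable (\<lambda>k. K * (\<gamma> / \<sigma>) ^ k)" using \<gamma> by (intro summable_mult summable_geometric) simp
    show "norm (homogeneous_part t A ?X k) \<le> K * (\<gamma> / \<sigma>) ^ k" if "k \<ge> 0" for k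
      using est(2)[of k] by (simp add: X(2) power_divide mult.commute)
  qed
  then show "homogeneous_part t A ?X sums free_eval t A ?X"
    unfolding free_eval_def by (rule summable_sums)
qed

text \<open>Complex linearity of the value of the series is what gives its adjoint, and with it the real
  part, the expected properties.\<close>

lemma sums_bounded_ops:
  fixes f :: "nat \<Rightarrow> 'a::complex_inner \<Rightarrow>\<^sub>L 'b::complex_inner"
  assumes "f sums T" "\<And>k. f k \<in> bounded_ops"
  shows "T \<in> bounded_ops"
proof -
  have ev: "(\<lambda>k. f k x) sums T x" for x
    using assms(1) by (rule bounded_linear.sums[OF blinfun.bounded_linear_left])
  have "T (c *\<^sub>C x) = c *\<^sub>C T x" for c x
  proof (rule sums_unique2)
    show "(\<lambda>k. f k (c *\<^sub>C x)) sums T (c *\<^sub>C x)" by (rule ev)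
    show "(\<lambda>k. f k (c *\<^sub>C x)) sums (c *\<^sub>C T x)"
      using bounded_linear.sums[OF bounded_linear_scaleC ev] assms(2) by (simp add: bounded_opsD)
  qed
  then show ?thesis by (simp add: bounded_ops_def)
qed

lemma Re_cinner_le_SUP_real_part:
  fixes T :: "'a::chilbert_space \<Rightarrow>\<^sub>L 'a"
  assumes T: "T \<in> bounded_ops"
  shows "Re (cinner (T y) y)
    \<le> (SUP y\<in>{y. norm y = 1}. Re (cinner (real_part T y) y)) * (norm y)\<^sup>2"
proof (cases "y = 0")
  case False
  let ?f = "\<lambda>y. Re (cinner (real_part T y) y)"
  have "bdd_above (?f ` {y. norm y = 1})"
  proof (rule bdd_aboveI2)
    fix y :: 'a assume "y \<in> {y. norm y = 1}"
    moreover have "?f y \<le> norm (real_part T y) * norm y"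
      using complex_Re_le_cmod norm_cinner_le order_trans by blast
    ultimately show "?f y \<le> norm (real_part T)" using norm_blinfun[of "real_part T" y] by simp
  qed
  then have "?f (sgn y) \<le> (SUP y\<in>{y. norm y = 1}. ?f y)"
    using False by (intro cSUP_upper) (auto simp: norm_sgn)
  moreover have "?f (sgn y) = Re (cinner (T y) y) / (norm y)\<^sup>2"
    unfolding Re_cinner_real_part[OF T]
    using False
    by (simp add: sgn_div_norm blinfun.scaleR_right cinner_scaleR_left cinner_scaleR_right
        power2_eq_square field_simps)
  ultimately show ?thesis using False by (simp add: pos_divide_le_eq)
qed simp

lemma sums_geometric_with_head:
  fixes r \<gamma> L a :: real
  assumes "0 < r" "r < \<gamma>"
  shows "(\<lambda>k. if k = 0 then a else L * (r / \<gamma>) ^ k) sums (a + L * r / (\<gamma> - r))"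
proof -
  have "(\<lambda>k. L * (r / \<gamma>) ^ k) sums (L * (1 / (1 - r / \<gamma>)))"
    using assms by (intro sums_mult geometric_sums) simp
  then have "(\<lambda>k. L * (r / \<gamma>) ^ k + (if k = 0 then a - L else 0)) sums (L * (1 / (1 - r / \<gamma>)) + (a - L))"
    using sums_single[of 0 "\<lambda>_. a - L"] by (rule sums_add)
  moreover have "(\<lambda>k. L * (r / \<gamma>) ^ k + (if k = 0 then a - L else 0))
      = (\<lambda>k. if k = 0 then a else L * (r / \<gamma>) ^ k)"
    by auto
  moreover have "L * (1 / (1 - r / \<gamma>)) + (a - L) = a + L * r / (\<gamma> - r)"
    using assms by (simp add: field_simps)
  ultimately show ?thesis by (simp only:)
qed

theorem theorem5p4:
  fixes tH :: "'h::chilbert_space \<Rightarrow> 'e::chilbert_space \<Rightarrow> 'k::chilbert_space"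
    and tS :: "'i::countable fock \<Rightarrow> 'e \<Rightarrow> 'm::chilbert_space"
    and F :: "('i \<Rightarrow> ('h \<Rightarrow>\<^sub>L 'h)) \<Rightarrow> ('k \<Rightarrow>\<^sub>L 'k)"
    and A :: "'i list \<Rightarrow> ('e \<Rightarrow>\<^sub>L 'e)"
    and \<gamma> s r :: real
  assumes "separable_hilbert TYPE('h)"
    and "infinite_dimensional TYPE('h)"
    and "\<exists>x::'e. x \<noteq> 0"
    and "hilbert_tensor tH"
    and "hilbert_tensor tS"
    and "0 < \<gamma>"
    and "\<gamma> < s"
    and "free_holomorphic_on tH s A F"
    and "F \<in> row_cball \<gamma> \<rightarrow> spatial_tensor tH"
    and "0 < r" and "r < \<gamma>"
  defines "A\<^sub>\<gamma> \<equiv> SUP y\<in>{y. norm y = 1}.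
             Re (cinner (blinfun_apply
               (real_part (free_eval tS A (\<lambda>i. \<gamma> *\<^sub>R left_creation i))) y) y)"
  shows "bdd_above ((\<lambda>X. norm (F X)) ` row_sphere r) \<and>
         (SUP X\<in>row_sphere r. norm (F X))
           \<le> 2 * r / (\<gamma> - r) * A\<^sub>\<gamma> + (\<gamma> + r) / (\<gamma> - r) * norm (F (\<lambda>_. 0))"
proof -
  note inf = \<open>infinite_dimensional TYPE('h)\<close> and F = \<open>free_holomorphic_on tH s A F\<close>
    and \<gamma> = \<open>0 < \<gamma>\<close> \<open>\<gamma> < s\<close> and r = \<open>0 < r\<close> \<open>r < \<gamma>\<close>
  interpret H: tensor tH using \<open>hilbert_tensor tH\<close> by unfold_locales
  obtain V :: "'i fock \<Rightarrow>\<^sub>L 'h" where V: "fock_isometry V"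
    using infinite_dimensional_imp_fock_isometry[OF inf] by blast
  note A = free_holomorphic_onD(1)[OF F]
  define T where "T = free_eval tS A (\<lambda>i. \<gamma> *\<^sub>R left_creation i)"
  define b where "b = norm (F (\<lambda>_. 0))"
  define L where "L = 2 * (A\<^sub>\<gamma> + b)"
  \<comment> \<open>any radius strictly between \<open>\<gamma>\<close> and \<open>s\<close> would do\<close>
  define \<sigma> where "\<sigma> = (\<gamma> + s) / 2"
  have \<sigma>: "0 < \<sigma>" "\<sigma> < s" "\<gamma> < \<sigma>" using \<gamma> by (auto simp: \<sigma>_def)
  obtain K where K: "K \<ge> 0" "\<And>k J x. finite J \<Longrightarrow> J \<subseteq> {w. length w = k} \<Longrightarrow>
      (\<Sum>w\<in>J. (norm (A w x))\<^sup>2) \<le> (K / \<sigma> ^ k)\<^sup>2 * (norm x)\<^sup>2"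
    using free_holomorphic_column_bound[OF \<open>hilbert_tensor tH\<close> inf F \<sigma>(1,2)] by blast
  note conv = free_series_on_fock_converges[OF \<open>hilbert_tensor tS\<close> A K \<gamma>(1) \<sigma>(3)]
  interpret S: weighted_shift tS A "\<lambda>i. \<gamma> *\<^sub>R left_creation i" ell2_basis \<gamma>
    by (rule weighted_shift_creation[OF \<open>hilbert_tensor tS\<close> A \<gamma>(1) conv(1)])
  have T: "homogeneous_part tS A (\<lambda>i. \<gamma> *\<^sub>R left_creation i) sums T"
    unfolding T_def by (rule conv(2))
  have a: "Re (cinner (T y) y) \<le> A\<^sub>\<gamma> * (norm y)\<^sup>2" for y
    unfolding A\<^sub>\<gamma>_def T_def[symmetric]
    by (intro Re_cinner_le_SUP_real_part sums_bounded_ops[OF T] S.homogeneous_part_bounded_ops)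
  have F0: "F (\<lambda>_. 0) = tensor_op tH id_blinfun (A [])"
    using \<gamma> by (intro H.free_holomorphic_at_0[OF F]) simp
  have b: "norm (A [] y) \<le> b * norm y" for y
  proof -
    have "norm (V (ell2_basis [])) = 1"
      using fock_isometry.orthonormal_V_basis[OF V]
      by (intro norm_eq_1_cinner) (simp add: orthonormal_on_def)
    then show ?thesis
      using norm_blinfun[of "F (\<lambda>_. 0)" "tH (V (ell2_basis [])) y"]
      by (simp add: F0 b_def H.tensor_op_apply bounded_ops_id A H.norm_t)
  qed
  \<comment> \<open>the upper bound for the real part, tested on a vector of degree \<open>0\<close>\<close>
  have "L \<ge> 0"
  proof -
    obtain x :: 'e where "x \<noteq> 0" using \<open>\<exists>x::'e. x \<noteq> 0\<close> by blast
    let ?p = "tS (ell2_basis []) x"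
    have "Re (cinner (A [] x) x) \<le> A\<^sub>\<gamma> * (norm x)\<^sup>2"
      using a[of ?p] by (simp add: S.free_series_coefficient[OF T] S.norm_t S.norm_h)
    moreover have "- (b * (norm x)\<^sup>2) \<le> Re (cinner (A [] x) x)" by (rule Re_cinner_ge[OF b])
    ultimately have "0 \<le> (A\<^sub>\<gamma> + b) * (norm x)\<^sup>2" by (simp add: algebra_simps)
    then show ?thesis using \<open>x \<noteq> 0\<close> by (simp add: L_def zero_le_mult_iff)
  qed
  have bound: "norm (F X) \<le> b + L * r / (\<gamma> - r)" if X: "X \<in> row_sphere r" for X
  proof -
    let ?g = "\<lambda>k. if k = 0 then b else L * (r / \<gamma>) ^ k"
    have Xop: "X \<in> op_tuples" "row_norm X = r" using X by (auto simp: row_sphere_def)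
    have FX: "homogeneous_part tH A X sums F X"
      using free_holomorphic_onD(3)[OF F] Xop r \<gamma> by (simp add: row_ball_def)
    have g: "?g sums (b + L * r / (\<gamma> - r))" by (rule sums_geometric_with_head[OF r])
    have "norm (homogeneous_part tH A X k) \<le> ?g k" for k
    proof (cases "k = 0")
      case True
      then show ?thesis by (simp add: homogeneous_part_0 b_def F0)
    next
      case False
      have "norm (homogeneous_part tH A X k) \<le> row_norm X ^ k * (L / \<gamma> ^ k)"
      proof (rule H.homogeneous_part_estimate(2)[OF Xop(1) A])
        show "0 \<le> L / \<gamma> ^ k" using \<open>L \<ge> 0\<close> \<gamma> by simp
        show "(\<Sum>w\<in>J. (norm (A w y))\<^sup>2) \<le> (L / \<gamma> ^ k)\<^sup>2 * (norm y)\<^sup>2"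
          if "finite J" "J \<subseteq> {w. length w = k}" for J y
          unfolding L_def using False that by (intro S.column_le_real_part_bound[OF T a b]) auto
      qed
      then show ?thesis using False by (simp add: Xop power_divide mult.commute)
    qed
    then have "norm (\<Sum>k. homogeneous_part tH A X k) \<le> suminf ?g"
      using sums_summable[OF g] by (intro norm_suminf_le)
    then show ?thesis by (simp only: sums_unique[OF FX, symmetric] sums_unique[OF g, symmetric])
  qed
  \<comment> \<open>the supremum over the sphere is only meaningful if the sphere is not empty\<close>
  have "transported_creation V r \<in> row_sphere r"
    using fock_isometry.transported_creation_op_tuples[OF V]
      fock_isometry.row_norm_transported_creation[OF V, of r] r by (simp add: row_sphere_def)
  then have "(SUP X\<in>row_sphere r. norm (F X)) \<le> b + L * r / (\<gamma> - r)"
    using bound by (intro cSUP_least) auto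
  also have "\<dots> = 2 * r / (\<gamma> - r) * A\<^sub>\<gamma> + (\<gamma> + r) / (\<gamma> - r) * b"
  proof -
    have "b + L * r / (\<gamma> - r) = (b * (\<gamma> - r) + L * r) / (\<gamma> - r)"
      using r by (simp add: add_divide_distrib)
    also have "b * (\<gamma> - r) + L * r = 2 * r * A\<^sub>\<gamma> + (\<gamma> + r) * b"
      by (simp add: L_def algebra_simps)
    finally show ?thesis by (simp only: times_divide_eq_left flip: add_divide_distrib)
  qed
  finally have "(SUP X\<in>row_sphere r. norm (F X))
      \<le> 2 * r / (\<gamma> - r) * A\<^sub>\<gamma> + (\<gamma> + r) / (\<gamma> - r) * norm (F (\<lambda>_. 0))"
    unfolding b_def .
  moreover have "bdd_above ((\<lambda>X. norm (F X)) ` row_sphere r)"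
    by (rule bdd_aboveI2) (rule bound)
  ultimately show ?thesis by blast
qed

end
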